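(* Let $a_0>0$, $b_0\in\mathbb R$, and let $H$ be a Jacobi operator on $\ell^2(\mathbb Z)$, $Hf(n)=a(n-1)f(n-1)+b(n)f(n)+a(n)f(n+1)$ with $a(n)>0$, $b(n)\in\mathbb R$, satisfying $$\sum_{n\in\mathbb Z}|n|\big(|a(n)-a_0|+|b(n)-b_0|\big)<\infty.$$ Let $\hat z\in\{1,-1\}$ and suppose that the Wronskian $W(z)$ of the Jost solutions satisfies $W(\hat z)=0$ (resonance case at the edge of the spectrum corresponding to $\hat z$). Then the reflection coefficients $R_+(z)$ and $R_-(z)$ are continuous at $\hat z$, i.e. the limits of $R_\pm(z)$ as $z\to\hat z$, $|z|=1$, exist.
   Context: The spectral parameter is $\lambda=b_0+a_0(z+z^{-1})$, $|z|\le1$; the continuous spectrum is $[b_0-2a_0,b_0+2a_0]$, corresponding to $|z|=1$, and its edges correspond to $z=\pm1$. The Jost solutions $\varphi_\pm(z,n)$, $0<|z|\le1$, are the solutions of $H\varphi=\lambda\varphi$ asymptotically close to $z^{\pm n}$ as $n\to\pm\infty$, i.e. $\lim_{n\to\pm\infty}z^{\mp n}\varphi_\pm(z,n)=1$. Their Wronskian is $W(z)=a(0)(\varphi_-(z,0)\varphi_+(z,1)-\varphi_-(z,1)\varphi_+(z,0))$. For $|z|=1$, $z\ne\pm1$, the transmission and reflection coefficients $T_\pm,R_\pm$ are defined by the scattering relations $T_\mp(z)\varphi_\pm(z,n)=\overline{\varphi_\mp(z,n)}+R_\mp(z)\varphi_\mp(z,n)$, $n\in\mathbb Z$. *)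

theory Defs
  imports "HOL-Analysis.Analysis"
begin

text \<open>
  The Jacobi difference expression is applied to arbitrary complex sequences on the integers:
  the Jost solutions are in general not square summable.
\<close>

definition jacobi :: "(int \<Rightarrow> real) \<Rightarrow> (int \<Rightarrow> real) \<Rightarrow> (int \<Rightarrow> complex) \<Rightarrow> int \<Rightarrow> complex" where
  "jacobi a b f n =
     of_real (a (n - 1)) * f (n - 1) + of_real (b n) * f n + of_real (a n) * f (n + 1)"

definition spectral_param :: "real \<Rightarrow> real \<Rightarrow> complex \<Rightarrow> complex" where
  "spectral_param a0 b0 z = of_real b0 + of_real a0 * (z + inverse z)"

definition is_jost_plus ::
  "real \<Rightarrow> real \<Rightarrow> (int \<Rightarrow> real) \<Rightarrow> (int \<Rightarrow> real) \<Rightarrow> complex \<Rightarrow> (int \<Rightarrow> complex) \<Rightarrow> bool" where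
  "is_jost_plus a0 b0 a b z \<phi> \<longleftrightarrow>
     (\<forall>n. jacobi a b \<phi> n = spectral_param a0 b0 z * \<phi> n) \<and>
     ((\<lambda>n. z powi (- n) * \<phi> n) \<longlongrightarrow> 1) at_top"

definition is_jost_minus ::
  "real \<Rightarrow> real \<Rightarrow> (int \<Rightarrow> real) \<Rightarrow> (int \<Rightarrow> real) \<Rightarrow> complex \<Rightarrow> (int \<Rightarrow> complex) \<Rightarrow> bool" where
  "is_jost_minus a0 b0 a b z \<phi> \<longleftrightarrow>
     (\<forall>n. jacobi a b \<phi> n = spectral_param a0 b0 z * \<phi> n) \<and>
     ((\<lambda>n. z powi n * \<phi> n) \<longlongrightarrow> 1) at_bot"

text \<open>
  Under the first-moment condition on the coefficients, the Jost solutions exist and are unique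
  for \<open>0 < norm z \<le> 1\<close>; outside this range the following two functions carry no meaning.
\<close>

definition jost_plus ::
  "real \<Rightarrow> real \<Rightarrow> (int \<Rightarrow> real) \<Rightarrow> (int \<Rightarrow> real) \<Rightarrow> complex \<Rightarrow> int \<Rightarrow> complex" where
  "jost_plus a0 b0 a b z = (THE \<phi>. is_jost_plus a0 b0 a b z \<phi>)"

definition jost_minus ::
  "real \<Rightarrow> real \<Rightarrow> (int \<Rightarrow> real) \<Rightarrow> (int \<Rightarrow> real) \<Rightarrow> complex \<Rightarrow> int \<Rightarrow> complex" where
  "jost_minus a0 b0 a b z = (THE \<phi>. is_jost_minus a0 b0 a b z \<phi>)"

definition jost_wronskian ::
  "real \<Rightarrow> real \<Rightarrow> (int \<Rightarrow> real) \<Rightarrow> (int \<Rightarrow> real) \<Rightarrow> complex \<Rightarrow> complex" where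
  "jost_wronskian a0 b0 a b z =
     of_real (a 0) * (jost_minus a0 b0 a b z 0 * jost_plus a0 b0 a b z 1
                      - jost_minus a0 b0 a b z 1 * jost_plus a0 b0 a b z 0)"

text \<open>
  The pairs \<open>(T, R)\<close> below are uniquely determined by the scattering relations
  for \<open>norm z = 1\<close>, \<open>z \<noteq> 1\<close>, \<open>z \<noteq> -1\<close>; they are not used at other points.
\<close>

definition scattering_plus ::
  "real \<Rightarrow> real \<Rightarrow> (int \<Rightarrow> real) \<Rightarrow> (int \<Rightarrow> real) \<Rightarrow> complex \<Rightarrow> complex \<times> complex" where
  "scattering_plus a0 b0 a b z =
     (THE (T, R). \<forall>n. T * jost_minus a0 b0 a b z n
                      = cnj (jost_plus a0 b0 a b z n) + R * jost_plus a0 b0 a b z n)"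

definition scattering_minus ::
  "real \<Rightarrow> real \<Rightarrow> (int \<Rightarrow> real) \<Rightarrow> (int \<Rightarrow> real) \<Rightarrow> complex \<Rightarrow> complex \<times> complex" where
  "scattering_minus a0 b0 a b z =
     (THE (T, R). \<forall>n. T * jost_plus a0 b0 a b z n
                      = cnj (jost_minus a0 b0 a b z n) + R * jost_minus a0 b0 a b z n)"

definition refl_plus ::
  "real \<Rightarrow> real \<Rightarrow> (int \<Rightarrow> real) \<Rightarrow> (int \<Rightarrow> real) \<Rightarrow> complex \<Rightarrow> complex" where
  "refl_plus a0 b0 a b z = snd (scattering_plus a0 b0 a b z)"

definition refl_minus ::
  "real \<Rightarrow> real \<Rightarrow> (int \<Rightarrow> real) \<Rightarrow> (int \<Rightarrow> real) \<Rightarrow> complex \<Rightarrow> complex" where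
  "refl_minus a0 b0 a b z = snd (scattering_minus a0 b0 a b z)"

end

theory Submission
  imports Defs
begin

text \<open>
  Write \<open>f = \<phi>\<^sub>+(zhat)\<close>. Taking Wronskians in the scattering relation gives
  \<open>R\<^sub>+ = - W(\<phi>\<^sub>-, cnj \<phi>\<^sub>+) / W(\<phi>\<^sub>-, \<phi>\<^sub>+)\<close>, and in the resonance case both Wronskians vanish at
  \<open>zhat\<close>, where \<open>\<phi>\<^sub>-(zhat) = c f\<close> with a real \<open>c \<noteq> 0\<close>. If \<open>f(k) \<noteq> 0\<close> for a
  \<open>k \<in> {0, 1}\<close>, the Pluecker relation \<open>W(u,v) f(k) = W(u,f) v(k) - W(v,f) u(k)\<close>
  (\<open>wronskian_pluecker\<close>) reduces everything to the first-order vanishing of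
  \<open>W(\<phi>\<^sub>\<plusminus>(z), f)\<close>. The heart of the proof (\<open>wronskian_asymptotics\<close>) is
  \<open>W(\<phi>\<^sub>+(z), \<phi>\<^sub>+(zhat)) / (zhat - z) \<longlongrightarrow> a0\<close>, with limit \<open>- a0\<close> for \<open>\<phi>\<^sub>-\<close>.
  It follows that \<open>R\<^sub>+ \<longlongrightarrow> (c - 1/c) / (c + 1/c)\<close>, where the denominator is nonzero because \<open>c\<close>
  is real (\<open>reflection_quotient_tendsto\<close>); \<open>R\<^sub>-\<close> is treated by exchanging the two solutions.

  With a finite first moment only, the Jost solutions need not be differentiable in \<open>z\<close> at the
  edge, so the limit cannot be read off from a Taylor expansion. Instead, Green's identity on
  \<open>{1..N}\<close> expresses the Wronskian at \<open>0\<close> by the one at \<open>N\<close> and the sum of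
  \<open>(\<lambda> - \<lambda>\<^sub>0) \<phi>\<^sub>+(z,m) f(m)\<close>. Here \<open>\<lambda> - \<lambda>\<^sub>0 = a0 (z - zhat)\<^sup>2 / z\<close>, and with
  \<open>\<phi>\<^sub>+(z,m) = z\<^sup>m h(z,m)\<close>, \<open>w = z zhat\<close>, the quotient by \<open>zhat - z\<close> becomes \<open>a0\<close> times
  the sum of \<open>(1 - w) w\<^sup>m h(z,m+1) h(zhat,m+1)\<close>. Replacing \<open>h(z,m+1)\<close> by \<open>1\<close> costs a
  summable amount uniformly in \<open>z\<close>: by \<open>amp_minus_1_oscillation\<close>, \<open>(1 - z\<^sup>2) (h(z,m) - 1)\<close>
  is bounded by a tail of the perturbation, and these tails are summable exactly because of the
  first moment (\<open>summable_tails\<close>). What is left is summed by parts, which uses only that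
  \<open>h(zhat,\<cdot>)\<close> has bounded variation. Tannery's theorem then gives the limit.

  The factors \<open>h(z,n)\<close> come from a backward recursion for \<open>h\<close> and
  \<open>e(n) = a(n) (h(n) - h(n+1))\<close>, started from \<open>(1, 0)\<close> at a far away site. The potential
  \<open>norm h + C n norm e\<close> grows per step by a factor \<open>1 + C (n + 1) r(n)\<close> with \<open>r\<close> the size of
  the perturbation, whose product converges; this yields bounds and uniform
  convergence on the whole unit circle, edges included.
\<close>

section \<open>Tails of series\<close>

lemma suminf_tail_split:
  fixes f :: "nat \<Rightarrow> real"
  assumes "summable f"
  shows "(\<Sum>k. f (k + n)) = f n + (\<Sum>k. f (k + Suc n))"
proof -
  have "summable (\<lambda>k. f (k + n))" using assms by (simp add: summable_iff_shift)
  from suminf_split_head[OF this] show ?thesis by simp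
qed

lemma suminf_tail_nonneg:
  fixes f :: "nat \<Rightarrow> real"
  assumes "summable f" "\<And>n. f n \<ge> 0"
  shows "(\<Sum>k. f (k + n)) \<ge> 0"
  using assms by (intro suminf_nonneg) (auto simp: summable_iff_shift)

lemma suminf_tail_tendsto_0:
  fixes f :: "nat \<Rightarrow> real"
  assumes "summable f"
  shows "(\<lambda>n. \<Sum>k. f (k + n)) \<longlonglongrightarrow> 0"
  using suminf_exist_split2[OF assms] .

text \<open>
  Summation by parts: the sum of the first \<open>N\<close> tails differs from a partial sum of
  \<open>(n + 1) r(n)\<close> by \<open>N\<close> times the \<open>N\<close>-th tail, which a tail of the weighted series dominates.
\<close>
lemma summable_tails:
  fixes r :: "nat \<Rightarrow> real"
  assumes s: "summable (\<lambda>n. real (Suc n) * r n)" and nn: "\<And>n. r n \<ge> 0"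
  shows "summable (\<lambda>n. \<Sum>k. r (k + n))"
proof -
  let ?f = "\<lambda>n. real (Suc n) * r n"
  have r_le: "r n \<le> ?f n" for n using nn[of n] by (simp add: algebra_simps)
  have sr: "summable r"
    by (rule summable_comparison_test'[OF s, of 0]) (use r_le nn in auto)
  have parts: "(\<Sum>n<N. \<Sum>k. r (k + n)) = real N * (\<Sum>k. r (k + N)) + (\<Sum>n<N. ?f n)" for N
  proof (induction N)
    case (Suc N)
    show ?case using Suc suminf_tail_split[OF sr, of N] by (simp add: algebra_simps)
  qed simp
  have bound: "real N * (\<Sum>k. r (k + N)) \<le> (\<Sum>k. ?f (k + N))" for N
  proof -
    have "summable (\<lambda>k. r (k + N))" "summable (\<lambda>k. ?f (k + N))"
      using sr s summable_iff_shift[of r N] summable_iff_shift[of ?f N] by blast+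
    moreover have "real N * r (k + N) \<le> ?f (k + N)" for k
      by (intro mult_right_mono nn) simp
    ultimately show ?thesis
      by (simp only: suminf_mult[symmetric]) (intro suminf_le summable_mult)
  qed
  show ?thesis
  proof (rule summableI_nonneg_bounded)
    show "0 \<le> (\<Sum>k. r (k + n))" for n by (rule suminf_tail_nonneg[OF sr nn])
    show "(\<Sum>n<N. \<Sum>k. r (k + n)) \<le> (\<Sum>n. ?f n)" for N
      using parts[of N] bound[of N] suminf_split_initial_segment[OF s, of N] by simp
  qed
qed

text \<open>
  The difference of the two sides is increasing in \<open>n\<close> and tends to \<open>0\<close>.
\<close>
lemma norm_le_tail:
  fixes G :: "nat \<Rightarrow> complex"
  assumes "G \<longlonglongrightarrow> 0" "summable p" "\<And>n. norm (G n - G (Suc n)) \<le> K * p n"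
  shows "norm (G n) \<le> K * (\<Sum>k. p (k + n))"
proof -
  let ?f = "\<lambda>n. norm (G n) - K * (\<Sum>k. p (k + n))"
  have "?f n \<le> ?f (Suc n)" for n
  proof -
    have "norm (G n) \<le> norm (G (Suc n)) + K * p n"
      using assms(3)[of n] norm_triangle_ineq2[of "G n" "G (Suc n)"] by linarith
    then show ?thesis using suminf_tail_split[OF assms(2), of n] by (simp add: algebra_simps)
  qed
  then have "incseq ?f" by (rule incseq_SucI)
  moreover have "?f \<longlonglongrightarrow> 0 - K * 0"
    by (intro tendsto_intros tendsto_norm_zero suminf_tail_tendsto_0 assms)
  ultimately have "?f n \<le> 0 - K * 0" by (rule incseq_le)
  then show ?thesis by simp
qed

section \<open>Solutions of the Jacobi equation\<close>

definition wronskian :: "(int \<Rightarrow> real) \<Rightarrow> (int \<Rightarrow> complex) \<Rightarrow> (int \<Rightarrow> complex) \<Rightarrow> int \<Rightarrow> complex" where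
  "wronskian a u v n = of_real (a n) * (u n * v (n + 1) - u (n + 1) * v n)"

text \<open>Green's identity; summed over an interval it becomes the next lemma.\<close>
lemma wronskian_step:
  assumes "jacobi a b u n = l * u n" "jacobi a b v n = m * v n"
  shows "wronskian a u v n = wronskian a u v (n - 1) + (m - l) * u n * v n"
proof -
  have eqs: "of_real (a n) * u (n + 1) = l * u n - of_real (a (n - 1)) * u (n - 1) - of_real (b n) * u n"
    "of_real (a n) * v (n + 1) = m * v n - of_real (a (n - 1)) * v (n - 1) - of_real (b n) * v n"
    using assms by (simp_all add: jacobi_def algebra_simps)
  have "wronskian a u v n = u n * (of_real (a n) * v (n + 1)) - (of_real (a n) * u (n + 1)) * v n"
    by (simp add: wronskian_def algebra_simps)
  also have "\<dots> = wronskian a u v (n - 1) + (m - l) * u n * v n"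
    unfolding eqs by (simp add: wronskian_def algebra_simps)
  finally show ?thesis .
qed

lemma wronskian_eq_sum:
  assumes "\<And>n. jacobi a b u n = l * u n" "\<And>n. jacobi a b v n = m * v n"
  shows "wronskian a u v (int N) = wronskian a u v 0 + (m - l) * (\<Sum>k<N. u (int (Suc k)) * v (int (Suc k)))"
proof (induction N)
  case (Suc N)
  show ?case using wronskian_step[OF assms, of "int (Suc N)"] Suc by (simp add: algebra_simps)
qed simp

lemma wronskian_const:
  assumes "\<And>n. jacobi a b u n = l * u n" "\<And>n. jacobi a b v n = l * v n"
  shows "wronskian a u v (int N) = wronskian a u v 0"
  using wronskian_eq_sum[OF assms] by simp

lemma wronskian_pluecker:
  assumes "k \<in> {n, n + 1}"
  shows "wronskian a u v n * f k = wronskian a u f n * v k - wronskian a v f n * u k"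
  using assms by (auto simp: wronskian_def algebra_simps)

lemma jacobi_lincomb:
  "jacobi a b (\<lambda>n. c * u n + d * v n) n = c * jacobi a b u n + d * jacobi a b v n"
  by (simp add: jacobi_def algebra_simps)

lemma solution_eq_0:
  assumes a: "\<And>n. a n > 0" and u: "\<And>n. jacobi a b u n = l * u n"
    and zero: "u k = 0" "u (k + 1) = 0"
  shows "u n = 0"
proof -
  have "u n = 0 \<and> u (n + 1) = 0"
  proof (induction n rule: int_induct[where k = k])
    case base
    show ?case using zero by simp
  next
    case (step1 i)
    then show ?case using u[of "i + 1"] a[of "i + 1"] by (simp add: jacobi_def algebra_simps)
  next
    case (step2 i)
    then show ?case using u[of i] a[of "i - 1"] by (simp add: jacobi_def algebra_simps)
  qed
  then show ?thesis by simp
qed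

lemma solution_unique:
  assumes a: "\<And>n. a n > 0" and u: "\<And>n. jacobi a b u n = l * u n" and v: "\<And>n. jacobi a b v n = l * v n"
    and "u k = v k" "u (k + 1) = v (k + 1)"
  shows "u = v"
proof
  fix n
  let ?d = "\<lambda>n. 1 * u n + (- 1) * v n"
  have "jacobi a b ?d n = l * ?d n" for n
    unfolding jacobi_lincomb u v by (simp add: algebra_simps)
  then have "?d n = 0"
    by (rule solution_eq_0[OF a, where k = k]) (use assms in auto)
  then show "u n = v n" by simp
qed

text \<open>The state after \<open>k\<close> steps consists of the values at the sites \<open>- k\<close> and \<open>1 - k\<close>.\<close>
primrec leftward :: "(int \<Rightarrow> real) \<Rightarrow> (int \<Rightarrow> real) \<Rightarrow> complex \<Rightarrow> complex \<times> complex \<Rightarrow> nat \<Rightarrow> complex \<times> complex" where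
  "leftward a b l s 0 = s"
| "leftward a b l s (Suc k) = (let (x, y) = leftward a b l s k in
     (((l - of_real (b (- int k))) * x - of_real (a (- int k)) * y) / of_real (a (- int k - 1)), x))"

text \<open>
  The half-line construction below only provides the values at the sites \<open>0, 1, 2, \<dots>\<close>. As no
  \<open>a(n)\<close> vanishes, the equation can be solved for the left neighbour.
\<close>
lemma solution_extends_left:
  fixes \<psi> :: "nat \<Rightarrow> complex"
  assumes a: "\<And>n. a n > 0"
    and \<psi>: "\<And>m. of_real (a (int m)) * \<psi> m + of_real (b (int m + 1)) * \<psi> (Suc m)
      + of_real (a (int m + 1)) * \<psi> (Suc (Suc m)) = l * \<psi> (Suc m)"
  shows "\<exists>\<phi>. (\<forall>n. \<phi> (int n) = \<psi> n) \<and> (\<forall>n. jacobi a b \<phi> n = l * \<phi> n)"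
proof -
  let ?L = "leftward a b l (\<psi> 0, \<psi> 1)"
  define \<phi> where "\<phi> n = (if n \<ge> 0 then \<psi> (nat n) else fst (?L (nat (- n))))" for n
  have L: "?L k = (\<phi> (- int k), \<phi> (1 - int k))" for k
  proof (rule prod_eqI)
    have left: "fst (?L k) = \<phi> (- int k)" for k by (cases "k = 0") (simp_all add: \<phi>_def)
    show "fst (?L k) = fst (\<phi> (- int k), \<phi> (1 - int k))" by (simp only: left fst_conv)
    show "snd (?L k) = snd (\<phi> (- int k), \<phi> (1 - int k))"
    proof (cases k)
      case (Suc i)
      then show ?thesis using left[of i] by (simp add: Let_def case_prod_beta)
    qed (simp add: \<phi>_def)
  qed
  have "jacobi a b \<phi> n = l * \<phi> n" for n
  proof (cases "n > 0")
    case True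
    define m where "m = nat (n - 1)"
    have n: "n = int m + 1" using True by (simp add: m_def)
    have "nat (int m + 1) = Suc m" "nat (int m + 2) = Suc (Suc m)" by auto
    then have "\<phi> (int m) = \<psi> m" "\<phi> (int m + 1) = \<psi> (Suc m)" "\<phi> (int m + 2) = \<psi> (Suc (Suc m))"
      by (simp_all add: \<phi>_def)
    then show ?thesis using \<psi>[of m] by (simp add: n jacobi_def add.commute)
  next
    case False
    define k where "k = nat (- n)"
    have n: "n = - int k" using False by (simp add: k_def)
    have "\<phi> (- int k - 1) = ((l - of_real (b (- int k))) * \<phi> (- int k) - of_real (a (- int k)) * \<phi> (1 - int k)) / of_real (a (- int k - 1))"
    proof -
      have "\<phi> (- 1 - int k) = \<phi> (- int k - 1)" by (rule arg_cong[where f = \<phi>]) simp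
      then show ?thesis using L[of k] L[of "Suc k"] by (simp add: Let_def)
    qed
    then show ?thesis using a[of "- int k - 1"]
      by (simp add: n jacobi_def field_simps)
  qed
  moreover have "\<phi> (int n) = \<psi> n" for n by (simp add: \<phi>_def)
  ultimately show ?thesis by blast
qed

section \<open>The half-line problem\<close>

text \<open>
  The coefficients live on all of the integers, but only the sites \<open>0, 1, 2, \<dots>\<close> are
  required to be close to the free operator, so that the locale covers the right half-line and,
  after a reflection, the left one.
\<close>
locale jacobi_half_line =
  fixes a0 b0 :: real and a b :: "int \<Rightarrow> real"
  assumes a0_pos: "a0 > 0" and a_pos: "a n > 0"
    and first_moment: "summable (\<lambda>n. real (Suc n) *
      (\<bar>a (int n) - a0\<bar> + \<bar>a (int n + 1) - a0\<bar> + \<bar>b (int n + 1) - b0\<bar>))"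
begin

definition pert :: "nat \<Rightarrow> real" where
  "pert n = \<bar>a (int n) - a0\<bar> + \<bar>a (int n + 1) - a0\<bar> + \<bar>b (int n + 1) - b0\<bar>"

lemma pert_nonneg: "pert n \<ge> 0"
  by (simp add: pert_def)

lemma summable_weighted_pert: "summable (\<lambda>n. real (Suc n) * pert n)"
  using first_moment by (simp add: pert_def)

lemma summable_pert: "summable pert"
proof (rule summable_comparison_test'[OF summable_weighted_pert, of 0])
  show "norm (pert n) \<le> real (Suc n) * pert n" for n
    using pert_nonneg[of n] by (simp add: algebra_simps)
qed

lemma a_tendsto: "(\<lambda>n. a (int n)) \<longlonglongrightarrow> a0"
proof -
  have "(\<lambda>n. a (int n) - a0) \<longlonglongrightarrow> 0"
    by (rule Lim_null_comparison[OF _ summable_LIMSEQ_zero[OF summable_pert]])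
       (simp add: pert_def)
  then show ?thesis by (simp add: LIM_zero_iff)
qed

lemma inverse_a_bounded: "\<exists>C>0. \<forall>n. 1 / a (int n) \<le> C"
proof -
  have "(\<lambda>n. 1 / a (int n)) \<longlonglongrightarrow> 1 / a0"
    by (intro tendsto_intros a_tendsto) (use a0_pos in simp)
  then have "Bseq (\<lambda>n. 1 / a (int n))" by (rule convergent_imp_Bseq[OF convergentI])
  then obtain C where "C > 0" "\<And>n. norm (1 / a (int n)) \<le> C" by (rule BseqE) auto
  moreover have "norm (1 / a (int n)) = 1 / a (int n)" for n using a_pos[of "int n"] by simp
  ultimately show ?thesis by metis
qed

definition inv_a_bound :: real where
  "inv_a_bound = (SOME C. C > 0 \<and> (\<forall>n. 1 / a (int n) \<le> C))"

lemma inv_a_bound: "inv_a_bound > 0" "1 / a (int n) \<le> inv_a_bound"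
  using someI_ex[OF inverse_a_bounded, folded inv_a_bound_def] by auto

text \<open>
  Substituting \<open>\<phi>(n) = z\<^sup>n h(n)\<close> in the Jacobi equation at the site \<open>n + 1\<close> and putting
  \<open>e(n) = a(n) (h(n) - h(n+1))\<close> turns it into the first-order system
  \<open>e(n) = z\<^sup>2 e(n+1) - coupling(n) h(n+1)\<close> and \<open>h(n) = h(n+1) + e(n) / a(n)\<close>. All deviations
  from the free operator are collected in the coupling, and \<open>back_step\<close> performs one step of the
  system on the pair \<open>(h, e)\<close>.
\<close>
definition coupling :: "complex \<Rightarrow> nat \<Rightarrow> complex" where
  "coupling z n = z * of_real (b (int n + 1) - b0) + of_real (a (int n) - a0)
     + z\<^sup>2 * of_real (a (int n + 1) - a0)"

lemma norm_coupling_le: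
  assumes "norm z = 1" shows "norm (coupling z n) \<le> pert n"
proof -
  have "norm (coupling z n) \<le> norm (z * of_real (b (int n + 1) - b0)) + norm (of_real (a (int n) - a0) :: complex)
     + norm (z\<^sup>2 * of_real (a (int n + 1) - a0))"
    unfolding coupling_def by (intro order.trans[OF norm_triangle_ineq] add_mono order.refl)
  then show ?thesis using assms by (simp add: pert_def norm_mult norm_power del: of_real_diff)
qed

definition back_step :: "complex \<Rightarrow> nat \<Rightarrow> complex \<times> complex \<Rightarrow> complex \<times> complex" where
  "back_step z n s = (let e = z\<^sup>2 * snd s - coupling z n * fst s in (fst s + e / of_real (a (int n)), e))"

text \<open>
  The pair at the site \<open>n\<close> for the solution which is free from the site \<open>n + j\<close> on. Counting the
  distance \<open>j\<close> to the cut-off, instead of naming the cut-off, makes the backward recursion primitive.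
\<close>
primrec trunc :: "nat \<Rightarrow> complex \<Rightarrow> nat \<Rightarrow> complex \<times> complex" where
  "trunc 0 z n = (1, 0)"
| "trunc (Suc j) z n = back_step z n (trunc j z (Suc n))"

definition weight :: "nat \<Rightarrow> real" where
  "weight n = inv_a_bound * (real (Suc n) * pert n)"

lemma weight_nonneg: "weight n \<ge> 0"
  using inv_a_bound(1) pert_nonneg by (simp add: weight_def)

lemma summable_weight: "summable weight"
  unfolding weight_def by (intro summable_mult summable_weighted_pert)

lemma fst_back_step: "fst (back_step z n s) = fst s + snd (back_step z n s) / of_real (a (int n))"
  and snd_back_step: "snd (back_step z n s) = z\<^sup>2 * snd s - coupling z n * fst s"
  by (simp_all add: back_step_def Let_def)

lemma norm_snd_back_step_le:
  assumes "norm z = 1"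
  shows "norm (snd (back_step z n s)) \<le> norm (snd s) + pert n * norm (fst s)"
proof -
  have "norm (snd (back_step z n s)) \<le> norm (z\<^sup>2 * snd s) + norm (coupling z n * fst s)"
    unfolding snd_back_step by (rule norm_triangle_ineq4)
  also have "\<dots> \<le> norm (snd s) + pert n * norm (fst s)"
    using assms norm_coupling_le[OF assms, of n]
    by (auto simp: norm_mult norm_power intro!: mult_right_mono)
  finally show ?thesis .
qed

text \<open>
  The weight \<open>n\<close> in front of \<open>e\<close> is what makes one backward step cheap: since the weight drops by
  one per step, the contribution of \<open>e(n) / a(n)\<close> to \<open>h(n)\<close> is paid for by the
  potential, and only the coupling term remains, with the factor \<open>n + 1\<close> of the first moment.
\<close>
definition potential :: "nat \<Rightarrow> complex \<Rightarrow> complex \<Rightarrow> real" where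
  "potential n h e = norm h + inv_a_bound * real n * norm e"

text \<open>
  The shift \<open>c\<close> is used with the value \<open>0\<close> for growth bounds and with the value \<open>1\<close> for the
  distance to the free solution.
\<close>
lemma potential_back_step_le:
  assumes "norm z = 1"
  shows "potential n (fst (back_step z n s) - c) (snd (back_step z n s)) \<le>
    potential (Suc n) (fst s - c) (snd s) + weight n * norm (fst s)"
proof -
  let ?e = "snd (back_step z n s)" and ?C = inv_a_bound
  have "norm (?e / of_real (a (int n))) = 1 / a (int n) * norm ?e"
    using a_pos[of "int n"] by (simp add: norm_divide)
  also have "\<dots> \<le> ?C * norm ?e" by (intro mult_right_mono inv_a_bound) auto
  finally have "norm (fst (back_step z n s) - c) \<le> norm (fst s - c) + ?C * norm ?e"
    unfolding fst_back_step[of z n s]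
    using norm_triangle_ineq[of "fst s - c" "?e / of_real (a (int n))"] by (simp add: algebra_simps)
  then have "potential n (fst (back_step z n s) - c) ?e \<le> norm (fst s - c) + ?C * real (Suc n) * norm ?e"
    by (simp add: potential_def algebra_simps)
  also have "\<dots> \<le> norm (fst s - c) + ?C * real (Suc n) * (norm (snd s) + pert n * norm (fst s))"
    by (intro add_left_mono mult_left_mono norm_snd_back_step_le assms) (use inv_a_bound(1) in simp)
  also have "\<dots> = potential (Suc n) (fst s - c) (snd s) + weight n * norm (fst s)"
    by (simp add: potential_def weight_def algebra_simps)
  finally show ?thesis .
qed

lemma potential_ge: "norm h \<le> potential n h e"
  using inv_a_bound(1) by (simp add: potential_def)

definition growth :: real where "growth = exp (suminf weight)"

lemma growth_pos: "growth > 0" by (simp add: growth_def)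

text \<open>
  Stated for an arbitrary solution of the recursion, because it is applied to truncated solutions
  and to differences of two of them.
\<close>
lemma backward_gronwall:
  assumes z: "norm z = 1"
    and step: "\<And>i. i < j \<Longrightarrow> s (n + i) = back_step z (n + i) (s (Suc (n + i)))"
  shows "potential n (fst (s n)) (snd (s n)) \<le>
    growth * potential (n + j) (fst (s (n + j))) (snd (s (n + j)))"
proof -
  have "potential n (fst (s n)) (snd (s n)) \<le>
      exp (\<Sum>i<j. weight (n + i)) * potential (n + j) (fst (s (n + j))) (snd (s (n + j)))"
    using step
  proof (induction j)
    case 0
    then show ?case by simp
  next
    case (Suc j)
    let ?P = "\<lambda>m. potential m (fst (s m)) (snd (s m))"
    have "?P (n + j) \<le> ?P (Suc (n + j)) + weight (n + j) * norm (fst (s (Suc (n + j))))"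
      using potential_back_step_le[OF z, of "n + j" "s (Suc (n + j))" 0] Suc.prems[of j] by simp
    also have "\<dots> \<le> (1 + weight (n + j)) * ?P (Suc (n + j))"
      using mult_left_mono[OF potential_ge[of "fst (s (Suc (n + j)))" "Suc (n + j)" "snd (s (Suc (n + j)))"]
        weight_nonneg[of "n + j"]]
      by (simp add: algebra_simps)
    also have "\<dots> \<le> exp (weight (n + j)) * ?P (Suc (n + j))"
      using order.trans[OF norm_ge_zero potential_ge]
      by (intro mult_right_mono exp_ge_add_one_self) auto
    finally have "?P (n + j) \<le> exp (weight (n + j)) * ?P (Suc (n + j))" .
    moreover have "?P n \<le> exp (\<Sum>i<j. weight (n + i)) * ?P (n + j)"
      by (rule Suc.IH) (use Suc.prems in auto)
    ultimately have "?P n \<le> exp (\<Sum>i<j. weight (n + i)) * (exp (weight (n + j)) * ?P (Suc (n + j)))"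
      by (meson order.trans mult_left_mono exp_ge_zero)
    then show ?case by (simp add: exp_add mult.assoc)
  qed
  also have "\<dots> \<le> growth * potential (n + j) (fst (s (n + j))) (snd (s (n + j)))"
  proof (rule mult_right_mono)
    have "(\<Sum>i<j. weight (n + i)) = (\<Sum>i\<in>{n..<n+j}. weight i)"
      by (rule sum.reindex_bij_witness[of _ "\<lambda>i. i - n" "\<lambda>i. n + i"]) auto
    also have "\<dots> \<le> suminf weight"
      by (intro sum_le_suminf summable_weight weight_nonneg) auto
    finally show "exp (\<Sum>i<j. weight (n + i)) \<le> growth" by (simp add: growth_def)
  qed (use order.trans[OF norm_ge_zero potential_ge] in auto)
  finally show ?thesis .
qed

lemma norm_fst_trunc_le:
  assumes "norm z = 1" shows "norm (fst (trunc j z n)) \<le> growth"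
proof -
  have "potential n (fst (trunc (n + j - n) z n)) (snd (trunc (n + j - n) z n)) \<le>
    growth * potential (n + j) (fst (trunc (n + j - (n + j)) z (n + j))) (snd (trunc (n + j - (n + j)) z (n + j)))"
    by (rule backward_gronwall[OF assms, where s = "\<lambda>m. trunc (n + j - m) z m"])
       (simp flip: trunc.simps(2) add: Suc_diff_Suc)
  then show ?thesis
    using potential_ge[of "fst (trunc j z n)" n "snd (trunc j z n)"] by (simp add: potential_def)
qed

lemma potential_trunc_minus_1_le:
  assumes "norm z = 1"
  shows "potential n (fst (trunc j z n) - 1) (snd (trunc j z n)) \<le> growth * (\<Sum>k. weight (k + n))"
proof (induction j arbitrary: n)
  case 0
  show ?case using growth_pos suminf_tail_nonneg[OF summable_weight weight_nonneg, of n]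
    by (simp add: potential_def)
next
  case (Suc j)
  have "potential n (fst (trunc (Suc j) z n) - 1) (snd (trunc (Suc j) z n)) \<le>
     potential (Suc n) (fst (trunc j z (Suc n)) - 1) (snd (trunc j z (Suc n)))
       + weight n * norm (fst (trunc j z (Suc n)))"
    using potential_back_step_le[OF assms, of n "trunc j z (Suc n)" 1] by simp
  also have "\<dots> \<le> growth * (\<Sum>k. weight (k + Suc n)) + weight n * growth"
    by (intro add_mono Suc.IH mult_left_mono norm_fst_trunc_le assms weight_nonneg)
  also have "\<dots> = growth * (\<Sum>k. weight (k + n))"
    using suminf_tail_split[OF summable_weight, of n] by (simp add: algebra_simps)
  finally show ?case .
qed

lemma norm_snd_trunc_le:
  assumes "norm z = 1"
  shows "norm (snd (trunc j z n)) \<le> growth * (\<Sum>k. pert (k + n))"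
proof (induction j arbitrary: n)
  case 0
  show ?case using growth_pos suminf_tail_nonneg[OF summable_pert pert_nonneg, of n] by simp
next
  case (Suc j)
  have "norm (snd (trunc (Suc j) z n)) \<le> norm (snd (trunc j z (Suc n))) + pert n * norm (fst (trunc j z (Suc n)))"
    using norm_snd_back_step_le[OF assms] by simp
  also have "\<dots> \<le> growth * (\<Sum>k. pert (k + Suc n)) + pert n * growth"
    by (intro add_mono Suc.IH mult_left_mono norm_fst_trunc_le assms pert_nonneg)
  also have "\<dots> = growth * (\<Sum>k. pert (k + n))"
    using suminf_tail_split[OF summable_pert, of n] by (simp add: algebra_simps)
  finally show ?case .
qed

lemma back_step_diff: "back_step z n (s - t) = back_step z n s - back_step z n t"
  by (simp add: back_step_def Let_def algebra_simps diff_divide_distrib add_divide_distrib prod_eq_iff)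

definition trunc_error :: "nat \<Rightarrow> real" where
  "trunc_error n = growth * (growth * (\<Sum>k. weight (k + n)))"

lemma trunc_error_tendsto_0: "trunc_error \<longlonglongrightarrow> 0"
  unfolding trunc_error_def
  by (intro tendsto_mult_right_zero suminf_tail_tendsto_0 summable_weight)

text \<open>
  Both truncations solve the same linear recursion to the left of the site \<open>n + j\<close>, so their
  difference is controlled by its value there, where the shorter one is free.
\<close>
lemma norm_trunc_diff_le:
  assumes "norm z = 1"
  shows "norm (fst (trunc (j + k) z n) - fst (trunc j z n)) \<le> trunc_error (n + j)"
proof -
  let ?s = "\<lambda>m. trunc (n + j + k - m) z m - trunc (n + j - m) z m"
  have "?s (n + i) = back_step z (n + i) (?s (Suc (n + i)))" if "i < j" for i
  proof -
    have "n + j + k - (n + i) = Suc (n + j + k - Suc (n + i))" "n + j - (n + i) = Suc (n + j - Suc (n + i))"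
      using that by auto
    then show ?thesis unfolding back_step_diff by (metis trunc.simps(2))
  qed
  then have "potential n (fst (?s n)) (snd (?s n)) \<le>
      growth * potential (n + j) (fst (?s (n + j))) (snd (?s (n + j)))"
    by (rule backward_gronwall[OF assms])
  also have "\<dots> = growth * potential (n + j) (fst (trunc k z (n + j)) - 1) (snd (trunc k z (n + j)))"
    by simp
  also have "\<dots> \<le> trunc_error (n + j)"
    unfolding trunc_error_def
    by (intro mult_left_mono potential_trunc_minus_1_le assms) (use growth_pos in simp)
  finally have "potential n (fst (?s n)) (snd (?s n)) \<le> trunc_error (n + j)" .
  with potential_ge have "norm (fst (?s n)) \<le> trunc_error (n + j)" by (rule order.trans)
  then show ?thesis by simp
qed

definition amp :: "complex \<Rightarrow> nat \<Rightarrow> complex" where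
  "amp z n = lim (\<lambda>j. fst (trunc j z n))"

text \<open>The limit of the components \<open>e\<close> of the truncations, see \<open>trunc_tendsto_slope\<close>.\<close>
definition slope :: "complex \<Rightarrow> nat \<Rightarrow> complex" where
  "slope z n = of_real (a (int n)) * (amp z n - amp z (Suc n))"

lemma trunc_tendsto_amp:
  assumes "norm z = 1" shows "(\<lambda>j. fst (trunc j z n)) \<longlonglongrightarrow> amp z n"
proof -
  have "Cauchy (\<lambda>j. fst (trunc j z n))"
  proof (rule metric_CauchyI)
    fix \<epsilon> :: real assume "\<epsilon> > 0"
    then have "eventually (\<lambda>m. trunc_error m < \<epsilon> / 2) sequentially"
      using trunc_error_tendsto_0 by (intro order_tendstoD) auto
    then obtain N where N: "\<And>m. m \<ge> N \<Longrightarrow> trunc_error m < \<epsilon> / 2"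
      by (auto simp: eventually_sequentially)
    have near: "dist (fst (trunc m z n)) (fst (trunc N z n)) < \<epsilon> / 2" if "m \<ge> N" for m
      using norm_trunc_diff_le[OF assms, of N "m - N" n] N[of "n + N"] that by (simp add: dist_norm)
    have "dist (fst (trunc m z n)) (fst (trunc k z n)) < \<epsilon>" if "m \<ge> N" "k \<ge> N" for m k
      using near[OF that(1)] near[OF that(2)] by (rule dist_triangle_half_l)
    then show "\<exists>M. \<forall>m\<ge>M. \<forall>k\<ge>M. dist (fst (trunc m z n)) (fst (trunc k z n)) < \<epsilon>" by blast
  qed
  then show ?thesis unfolding amp_def by (simp add: Cauchy_convergent_iff convergent_LIMSEQ_iff)
qed

lemma norm_amp_minus_trunc_le:
  assumes "norm z = 1" shows "norm (amp z n - fst (trunc j z n)) \<le> trunc_error (n + j)"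
proof (rule LIMSEQ_le_const2)
  show "(\<lambda>k. norm (fst (trunc (j + k) z n) - fst (trunc j z n))) \<longlonglongrightarrow> norm (amp z n - fst (trunc j z n))"
    using LIMSEQ_ignore_initial_segment[OF trunc_tendsto_amp[OF assms, of n], of j]
    by (intro tendsto_intros) (simp add: add.commute)
qed (use norm_trunc_diff_le[OF assms] in blast)

lemma trunc_tendsto_slope:
  assumes "norm z = 1" shows "(\<lambda>j. snd (trunc j z n)) \<longlonglongrightarrow> slope z n"
proof -
  have "snd (trunc (Suc j) z n) = of_real (a (int n)) * (fst (trunc (Suc j) z n) - fst (trunc j z (Suc n)))" for j
    using a_pos[of "int n"] fst_back_step[of z n "trunc j z (Suc n)"] by simp
  moreover have "(\<lambda>j. of_real (a (int n)) * (fst (trunc (Suc j) z n) - fst (trunc j z (Suc n)))) \<longlonglongrightarrow> slope z n"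
    unfolding slope_def
    by (intro tendsto_intros trunc_tendsto_amp assms LIMSEQ_Suc)
  ultimately have "(\<lambda>j. snd (trunc (Suc j) z n)) \<longlonglongrightarrow> slope z n" by presburger
  then show ?thesis by (rule LIMSEQ_imp_Suc)
qed

lemma slope_rec:
  assumes "norm z = 1"
  shows "slope z n = z\<^sup>2 * slope z (Suc n) - coupling z n * amp z (Suc n)"
proof (rule LIMSEQ_unique)
  show "(\<lambda>j. snd (trunc (Suc j) z n)) \<longlonglongrightarrow> slope z n"
    using trunc_tendsto_slope[OF assms] by (rule LIMSEQ_Suc)
  show "(\<lambda>j. snd (trunc (Suc j) z n)) \<longlonglongrightarrow> z\<^sup>2 * slope z (Suc n) - coupling z n * amp z (Suc n)"
    unfolding trunc.simps snd_back_step
    by (intro tendsto_intros trunc_tendsto_slope trunc_tendsto_amp assms)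
qed

lemma norm_amp_le: assumes "norm z = 1" shows "norm (amp z n) \<le> growth"
  by (rule LIMSEQ_le_const2[OF tendsto_norm[OF trunc_tendsto_amp[OF assms]]])
     (use norm_fst_trunc_le[OF assms] in blast)

lemma norm_slope_le:
  assumes "norm z = 1" shows "norm (slope z n) \<le> growth * (\<Sum>k. pert (k + n))"
  by (rule LIMSEQ_le_const2[OF tendsto_norm[OF trunc_tendsto_slope[OF assms]]])
     (use norm_snd_trunc_le[OF assms] in blast)

lemma amp_tendsto_1:
  assumes "norm z = 1" shows "amp z \<longlonglongrightarrow> 1"
proof -
  have "norm (amp z n - 1) \<le> trunc_error n" for n
    using norm_amp_minus_trunc_le[OF assms, of n 0] by simp
  then have "(\<lambda>n. amp z n - 1) \<longlonglongrightarrow> 0"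
    by (intro Lim_null_comparison[OF _ trunc_error_tendsto_0]) simp
  then show ?thesis by (simp add: LIM_zero_iff)
qed

lemma continuous_on_trunc: "continuous_on UNIV (\<lambda>z. fst (trunc j z n)) \<and> continuous_on UNIV (\<lambda>z. snd (trunc j z n))"
proof (induction j arbitrary: n)
  case (Suc j)
  have "of_real (a (int n)) \<noteq> (0 :: complex)" using a_pos[of "int n"] by simp
  then show ?case using Suc[of "Suc n"]
    unfolding trunc.simps fst_back_step snd_back_step coupling_def
    by (auto intro!: continuous_intros)
qed simp

lemma continuous_on_amp: "continuous_on (sphere 0 1) (\<lambda>z. amp z n)"
proof (rule uniform_limit_theorem)
  show "\<forall>\<^sub>F j in sequentially. continuous_on (sphere 0 1) (\<lambda>z. fst (trunc j z n))"
    using continuous_on_trunc by (intro always_eventually allI) (blast intro: continuous_on_subset)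
  show "uniform_limit (sphere 0 1) (\<lambda>j z. fst (trunc j z n)) (\<lambda>z. amp z n) sequentially"
  proof (rule uniform_limitI)
    fix \<epsilon> :: real assume "\<epsilon> > 0"
    have "(\<lambda>j. trunc_error (n + j)) \<longlonglongrightarrow> 0"
      using LIMSEQ_ignore_initial_segment[OF trunc_error_tendsto_0, of n] by (simp add: add.commute)
    then have "\<forall>\<^sub>F j in sequentially. trunc_error (n + j) < \<epsilon>" 
      using \<open>\<epsilon> > 0\<close> by (intro order_tendstoD) auto
    then show "\<forall>\<^sub>F j in sequentially. \<forall>z\<in>sphere 0 1. dist (fst (trunc j z n)) (amp z n) < \<epsilon>"
    proof eventually_elim
      case (elim j)
      then show ?case using norm_amp_minus_trunc_le[of _ n j]
        by (fastforce simp: dist_norm norm_minus_commute intro: le_less_trans)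
    qed
  qed
qed simp

lemma slope_tendsto_0:
  assumes "norm z = 1" shows "slope z \<longlonglongrightarrow> 0"
proof (rule Lim_null_comparison)
  show "(\<lambda>n. growth * (\<Sum>k. pert (k + n))) \<longlonglongrightarrow> 0"
    by (intro tendsto_mult_right_zero suminf_tail_tendsto_0 summable_pert)
qed (use norm_slope_le[OF assms] in auto)

text \<open>
  Close to the edge, \<open>h - 1\<close> itself is in general not summable uniformly in \<open>z\<close>. The factor
  \<open>1 - z\<^sup>2\<close> exploits the oscillation of \<open>e\<close>: up to perturbative terms,
  \<open>(1 - z\<^sup>2) e(n)\<close> is a difference of consecutive values of \<open>e\<close>, so that summing it costs nothing,
  whereas the trivial bound would lose another factor \<open>n\<close>.
\<close>
lemma amp_minus_1_oscillation:
  "\<exists>K. \<forall>z n. norm z = 1 \<longrightarrow> norm (1 - z\<^sup>2) * norm (amp z n - 1) \<le> K * (\<Sum>k. pert (k + n))"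
proof (intro exI allI impI)
  fix z :: complex and n assume z: "norm z = 1"
  \<comment> \<open>The increments of \<open>G\<close> contain only terms with a factor of the perturbation: the free parts
    of both summands cancel by the recursion for the slope.\<close>
  define G where "G n = (1 - z\<^sup>2) * of_real a0 * (amp z n - 1) + z\<^sup>2 * slope z n" for n
  define K where "K = growth + 2 * (growth * (\<Sum>k. pert k)) * inv_a_bound"
  have step: "norm (G m - G (Suc m)) \<le> K * pert m" for m
  proof -
    have am: "of_real (a (int m)) \<noteq> (0 :: complex)" using a_pos[of "int m"] by simp
    have sl: "norm (slope z m) \<le> growth * (\<Sum>k. pert k)"
    proof (rule order.trans[OF norm_slope_le[OF z]], intro mult_left_mono)
      show "(\<Sum>k. pert (k + m)) \<le> (\<Sum>k. pert k)"
        using suminf_split_initial_segment[OF summable_pert, of m] sum_nonneg[of "{..<m}" pert] pert_nonneg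
        by simp
    qed (use growth_pos in simp)
    have diff: "amp z m - amp z (Suc m) = slope z m / of_real (a (int m))"
      using am by (simp add: slope_def)
    have "G m - G (Suc m) = (1 - z\<^sup>2) * of_real a0 * (amp z m - amp z (Suc m)) + z\<^sup>2 * slope z m - z\<^sup>2 * slope z (Suc m)"
      by (simp add: G_def algebra_simps)
    also have "\<dots> = (1 - z\<^sup>2) * slope z m * (of_real (a0 - a (int m)) / of_real (a (int m)))
        - coupling z m * amp z (Suc m)"
    proof -
      have "z\<^sup>2 * slope z (Suc m) = slope z m + coupling z m * amp z (Suc m)"
        using slope_rec[OF z, of m] by simp
      then show ?thesis using am unfolding diff by (simp add: field_simps)
    qed
    finally have "norm (G m - G (Suc m)) \<le>
        norm ((1 - z\<^sup>2) * slope z m * (of_real (a0 - a (int m)) / of_real (a (int m)))) + norm (coupling z m * amp z (Suc m))"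
      by (simp add: norm_triangle_ineq4)
    also have "\<dots> = norm (1 - z\<^sup>2) * norm (slope z m) * (\<bar>a0 - a (int m)\<bar> * (1 / a (int m)))
        + norm (coupling z m) * norm (amp z (Suc m))"
      using a_pos[of "int m"] by (simp add: norm_mult norm_divide del: of_real_diff)
    also have "\<dots> \<le> 2 * (growth * (\<Sum>k. pert k)) * (pert m * inv_a_bound) + pert m * growth"
    proof (intro add_mono mult_mono sl inv_a_bound norm_coupling_le norm_amp_le z)
      show "norm (1 - z\<^sup>2) \<le> 2"
        using norm_triangle_ineq4[of 1 "z\<^sup>2"] z by (simp add: norm_power)
      show "\<bar>a0 - a (int m)\<bar> \<le> pert m" by (simp add: pert_def)
      show "0 \<le> \<bar>a0 - a (int m)\<bar> * (1 / a (int m))" "0 \<le> 1 / a (int m)"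
        using a_pos[of "int m"] by auto
    qed (use growth_pos pert_nonneg suminf_nonneg[OF summable_pert pert_nonneg] in auto)
    also have "\<dots> = K * pert m" by (simp add: K_def algebra_simps)
    finally show ?thesis .
  qed
  have "G \<longlonglongrightarrow> (1 - z\<^sup>2) * of_real a0 * (1 - 1) + z\<^sup>2 * 0"
    unfolding G_def by (intro tendsto_intros amp_tendsto_1 slope_tendsto_0 z)
  then have "norm (G n) \<le> K * (\<Sum>k. pert (k + n))"
    by (intro norm_le_tail summable_pert step) simp
  moreover have "norm (z\<^sup>2 * slope z n) \<le> growth * (\<Sum>k. pert (k + n))"
    using norm_slope_le[OF z, of n] z by (simp add: norm_mult norm_power)
  moreover have "(1 - z\<^sup>2) * of_real a0 * (amp z n - 1) = G n - z\<^sup>2 * slope z n"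
    by (simp add: G_def)
  ultimately have "norm ((1 - z\<^sup>2) * of_real a0 * (amp z n - 1)) \<le> (K + growth) * (\<Sum>k. pert (k + n))"
    using norm_triangle_ineq4[of "G n" "z\<^sup>2 * slope z n"] unfolding distrib_right by simp
  then show "norm (1 - z\<^sup>2) * norm (amp z n - 1) \<le> (K + growth) / a0 * (\<Sum>k. pert (k + n))"
    using a0_pos unfolding norm_mult by (simp add: pos_le_divide_eq ac_simps)
qed

section \<open>Jost solutions\<close>

lemma jost_plus_exists:
  assumes z: "norm z = 1"
  shows "\<exists>\<phi>. is_jost_plus a0 b0 a b z \<phi> \<and> (\<forall>n. \<phi> (int n) = z ^ n * amp z n)"
proof -
  have z0: "z \<noteq> 0" using z by auto
  have "\<exists>\<phi>. (\<forall>n. \<phi> (int n) = z ^ n * amp z n) \<and> (\<forall>n. jacobi a b \<phi> n = spectral_param a0 b0 z * \<phi> n)"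
  proof (rule solution_extends_left[OF a_pos])
    fix m
    have "of_real (a (int m)) * amp z m + of_real (b (int m + 1)) * (z * amp z (Suc m))
      + of_real (a (int m + 1)) * (z * (z * amp z (Suc (Suc m)))) 
      = (of_real b0 * z + of_real a0 * (z\<^sup>2 + 1)) * amp z (Suc m)"
      using slope_rec[OF z, of m]
      by (simp add: slope_def coupling_def algebra_simps power2_eq_square)
    also have "of_real b0 * z + of_real a0 * (z\<^sup>2 + 1) = spectral_param a0 b0 z * z"
      using z0 by (simp add: spectral_param_def algebra_simps power2_eq_square)
    finally have "z ^ m * (of_real (a (int m)) * amp z m + of_real (b (int m + 1)) * (z * amp z (Suc m))
      + of_real (a (int m + 1)) * (z * (z * amp z (Suc (Suc m))))) =
      z ^ m * (spectral_param a0 b0 z * z * amp z (Suc m))" by (rule arg_cong)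
    then show "of_real (a (int m)) * (z ^ m * amp z m) + of_real (b (int m + 1)) * (z ^ Suc m * amp z (Suc m))
      + of_real (a (int m + 1)) * (z ^ Suc (Suc m) * amp z (Suc (Suc m))) = spectral_param a0 b0 z * (z ^ Suc m * amp z (Suc m))"
      by (simp add: algebra_simps)
  qed
  then obtain \<phi> where \<phi>: "\<And>n. \<phi> (int n) = z ^ n * amp z n"
    "\<And>n. jacobi a b \<phi> n = spectral_param a0 b0 z * \<phi> n" by blast
  have "((\<lambda>n. amp z (nat n)) \<longlongrightarrow> 1) at_top"
    using filterlim_compose[OF amp_tendsto_1[OF z] filterlim_nat_sequentially] .
  moreover have "\<forall>\<^sub>F n in at_top. amp z (nat n) = z powi (- n) * \<phi> n"
    using eventually_ge_at_top[of 0]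
  proof eventually_elim
    case (elim n)
    then have "\<phi> n = z powi n * amp z (nat n)"
      using \<phi>(1)[of "nat n"] by (simp add: power_int_def)
    then show ?case using z0 by (simp add: power_int_minus)
  qed
  ultimately have "((\<lambda>n. z powi (- n) * \<phi> n) \<longlongrightarrow> 1) at_top"
    by (rule Lim_transform_eventually)
  with \<phi> show ?thesis unfolding is_jost_plus_def by blast
qed

text \<open>
  The Wronskian of two candidates is constant and tends to \<open>0\<close>, hence they are proportional, and
  the normalization at infinity fixes the factor. The argument works at the edges as well, where
  \<open>\<phi>\<close> and its conjugate are dependent and cannot serve as a basis.
\<close>
lemma jost_plus_unique:
  assumes z: "norm z = 1" and "is_jost_plus a0 b0 a b z \<phi>" "is_jost_plus a0 b0 a b z \<psi>"
  shows "\<phi> = \<psi>"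
proof -
  have z0: "z \<noteq> 0" using z by auto
  have eqs: "\<And>n. jacobi a b \<phi> n = spectral_param a0 b0 z * \<phi> n" "\<And>n. jacobi a b \<psi> n = spectral_param a0 b0 z * \<psi> n"
    using assms by (auto simp: is_jost_plus_def)
  define A where "A n = z powi (- int n) * \<phi> (int n)" for n
  define B where "B n = z powi (- int n) * \<psi> (int n)" for n
  have \<phi>A: "\<phi> (int n) = z ^ n * A n" and \<psi>B: "\<psi> (int n) = z ^ n * B n" for n
    using z0 by (simp_all add: A_def B_def power_int_minus)
  have AB: "A \<longlonglongrightarrow> 1" "B \<longlonglongrightarrow> 1"
    using assms unfolding is_jost_plus_def A_def B_def
    by (auto intro: filterlim_compose[OF _ filterlim_int_sequentially])
  have "(\<lambda>n. norm (of_real (a (int n)) * (A n * B (Suc n) - A (Suc n) * B n))) \<longlonglongrightarrow> norm (of_real a0 * (1 * 1 - 1 * 1 :: complex))"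
    by (intro tendsto_intros a_tendsto AB LIMSEQ_Suc)
  moreover have "norm (of_real (a (int n)) * (A n * B (Suc n) - A (Suc n) * B n)) = norm (wronskian a \<phi> \<psi> 0)" for n
  proof -
    have "wronskian a \<phi> \<psi> 0 = wronskian a \<phi> \<psi> (int n)" by (rule wronskian_const[OF eqs, symmetric])
    also have "\<dots> = z ^ n * z ^ Suc n * (of_real (a (int n)) * (A n * B (Suc n) - A (Suc n) * B n))"
      using \<phi>A[of n] \<phi>A[of "Suc n"] \<psi>B[of n] \<psi>B[of "Suc n"] by (simp add: wronskian_def algebra_simps)
    finally show ?thesis using z by (simp add: norm_mult norm_power)
  qed
  ultimately have "norm (wronskian a \<phi> \<psi> 0) = 0" by (simp add: LIMSEQ_const_iff)
  then have cross: "\<phi> (int n) * \<psi> (int (Suc n)) = \<phi> (int (Suc n)) * \<psi> (int n)" for n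
  proof -
    have "wronskian a \<phi> \<psi> (int n) = 0" using wronskian_const[OF eqs, of n] \<open>norm (wronskian a \<phi> \<psi> 0) = 0\<close> by simp
    then show ?thesis using a_pos[of "int n"] by (simp add: wronskian_def add.commute)
  qed
  obtain N where N: "\<And>n. n \<ge> N \<Longrightarrow> B n \<noteq> 0"
    using tendsto_imp_eventually_ne[OF AB(2), of 0] by (auto simp: eventually_sequentially)
  then have nz: "\<psi> (int n) \<noteq> 0" if "n \<ge> N" for n using that \<psi>B z0 by simp
  have ratio: "\<phi> (int (N + n)) / \<psi> (int (N + n)) = \<phi> (int N) / \<psi> (int N)" for n
  proof (induction n)
    case (Suc n)
    have "\<phi> (int (N + Suc n)) / \<psi> (int (N + Suc n)) = \<phi> (int (N + n)) / \<psi> (int (N + n))"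
      using cross[of "N + n"] nz[of "N + n"] nz[of "N + Suc n"] by (simp add: frac_eq_eq)
    with Suc show ?case by simp
  qed simp
  have "(\<lambda>n. A n / B n) \<longlonglongrightarrow> 1 / 1" by (intro tendsto_intros AB) simp
  then have "(\<lambda>n. A (n + N) / B (n + N)) \<longlonglongrightarrow> 1" by (auto intro: LIMSEQ_ignore_initial_segment)
  moreover have "A (n + N) / B (n + N) = \<phi> (int N) / \<psi> (int N)" for n
    using ratio[of n] \<phi>A[of "n + N"] \<psi>B[of "n + N"] z0 by (simp add: add.commute)
  ultimately have "\<phi> (int N) / \<psi> (int N) = 1" by (simp add: LIMSEQ_const_iff)
  then have "\<phi> (int n) = \<psi> (int n)" if "n \<ge> N" for n
    using ratio[of "n - N"] nz[OF that] that by simp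
  from this[of N] this[of "Suc N"] show ?thesis
    by (intro solution_unique[OF a_pos eqs, where k = "int N"]) (simp_all add: add.commute)
qed

lemma is_jost_plus_jost_plus:
  assumes "norm z = 1" shows "is_jost_plus a0 b0 a b z (jost_plus a0 b0 a b z)"
  unfolding jost_plus_def
  using jost_plus_exists[OF assms] jost_plus_unique[OF assms] by (metis theI)

lemma jost_plus_eqI:
  assumes "norm z = 1" "is_jost_plus a0 b0 a b z \<phi>" shows "jost_plus a0 b0 a b z = \<phi>"
  using jost_plus_unique is_jost_plus_jost_plus assms by blast

lemma jost_plus_nat:
  assumes "norm z = 1" shows "jost_plus a0 b0 a b z (int n) = z ^ n * amp z n"
  using jost_plus_exists[OF assms] jost_plus_eqI[OF assms] by metis

lemma jost_plus_tendsto: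
  assumes "norm z = 1"
  shows "((\<lambda>z. jost_plus a0 b0 a b z (int n)) \<longlongrightarrow> jost_plus a0 b0 a b z (int n)) (at z within sphere 0 1)"
proof -
  have "continuous_on (sphere 0 1) (\<lambda>z. jost_plus a0 b0 a b z (int n))"
  proof (rule continuous_on_eq)
    show "continuous_on (sphere 0 1) (\<lambda>z. z ^ n * amp z n)"
      by (intro continuous_intros continuous_on_amp)
  qed (simp add: jost_plus_nat)
  then show ?thesis using assms by (simp add: continuous_on_def)
qed

section \<open>Wronskian with the solution at the edge\<close>

lemma spectral_param_diff:
  assumes "z \<noteq> 0" "zh \<in> {1, -1}"
  shows "spectral_param a0 b0 z - spectral_param a0 b0 zh = of_real a0 * ((z - zh)\<^sup>2 / z)"
  using assms by (auto simp: spectral_param_def field_simps power2_eq_square)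

text \<open>
  For fixed \<open>z\<close> the boundary term at \<open>N\<close> does not tend to \<open>0\<close> but oscillates like
  \<open>a0 w\<^sup>N\<close>; it is cancelled by the boundary term of the summation by parts. The combination is
  called \<open>E\<close> in the proof, and the terms of the remaining series are called \<open>t\<close>.
\<close>
lemma wronskian_asymptotics:
  assumes zh: "zh \<in> {1, -1 :: complex}"
  shows "((\<lambda>z. wronskian a (jost_plus a0 b0 a b z) (jost_plus a0 b0 a b zh) 0 / (zh - z)) \<longlongrightarrow> of_real a0)
    (at zh within sphere 0 1)"
proof -
  let ?F = "at zh within sphere 0 (1 :: real)"
  let ?J = "jost_plus a0 b0 a b"
  have nzh: "norm zh = 1" and sq: "zh * zh = 1" and zh0: "zh \<noteq> 0" using zh by auto
  define g where "g = amp zh"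
  define t where "t m z = (1 - z * zh) * (z * zh) ^ m * (amp z (Suc m) - 1) * g (Suc m)
    - (z * zh) ^ m * (g m - g (Suc m))" for m z
  obtain K where K: "\<And>z n. norm z = 1 \<Longrightarrow> norm (1 - z\<^sup>2) * norm (amp z n - 1) \<le> K * (\<Sum>k. pert (k + n))"
    using amp_minus_1_oscillation by blast
  define T where "T m = growth * (K * (\<Sum>k. pert (k + Suc m))) + inv_a_bound * (growth * (\<Sum>k. pert (k + m)))" for m
  have T: "summable T"
    unfolding T_def
    using summable_tails[OF summable_weighted_pert pert_nonneg]
      summable_Suc_iff[of "\<lambda>m. \<Sum>k. pert (k + m)"]
    by (intro summable_add summable_mult) blast+
  have near: "\<forall>\<^sub>F z in ?F. norm z = 1 \<and> z \<noteq> zh \<and> norm (1 - z * zh) \<le> norm (1 - z\<^sup>2)"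
  proof -
    have "\<forall>\<^sub>F z in ?F. z \<in> sphere 0 1 \<and> z \<noteq> zh \<and> dist z zh < 1"
      unfolding eventually_at by (intro exI[of _ 1]) auto
    then show ?thesis
    proof eventually_elim
      case (elim z)
      have factor: "1 - z\<^sup>2 = (1 - z * zh) * (1 + z * zh)"
        using sq by (simp add: algebra_simps power2_eq_square)
      have "1 \<le> norm (1 + z * zh)"
      proof -
        have "1 - z * zh = zh * (zh - z)" using sq by (simp add: algebra_simps)
        then have "norm (1 - z * zh) < 1" using elim nzh by (simp add: norm_mult dist_norm norm_minus_commute)
        moreover have "2 - norm (1 - z * zh) \<le> norm (1 + z * zh)"
          using norm_triangle_ineq2[of 2 "1 - z * zh"] by simp
        ultimately show ?thesis by simp
      qed
      then have "norm (1 - z * zh) * 1 \<le> norm (1 - z\<^sup>2)"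
        unfolding factor norm_mult by (rule mult_left_mono) simp
      then show ?case using elim by simp
    qed
  qed
  have t_bound: "norm (t m z) \<le> T m" if z: "norm z = 1" and wz: "norm (1 - z * zh) \<le> norm (1 - z\<^sup>2)" for m z
  proof -
    have near_1: "norm (1 - z * zh) * norm (amp z (Suc m) - 1) \<le> K * (\<Sum>k. pert (k + Suc m))"
      using mult_right_mono[OF wz, of "norm (amp z (Suc m) - 1)"] K[OF z, of "Suc m"] by simp
    have g_diff: "norm (g m - g (Suc m)) \<le> inv_a_bound * (growth * (\<Sum>k. pert (k + m)))"
    proof -
      have "g m - g (Suc m) = slope zh m / of_real (a (int m))"
        using a_pos[of "int m"] by (simp add: g_def slope_def)
      then have "norm (g m - g (Suc m)) = 1 / a (int m) * norm (slope zh m)"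
        using a_pos[of "int m"] by (simp add: norm_divide)
      also have "\<dots> \<le> inv_a_bound * (growth * (\<Sum>k. pert (k + m)))"
        by (rule mult_mono[OF inv_a_bound(2) norm_slope_le[OF nzh]]) (use inv_a_bound(1) in auto)
      finally show ?thesis .
    qed
    have "norm (t m z) \<le> norm ((1 - z * zh) * (z * zh) ^ m * (amp z (Suc m) - 1) * g (Suc m))
        + norm ((z * zh) ^ m * (g m - g (Suc m)))"
      unfolding t_def by (rule norm_triangle_ineq4)
    also have "\<dots> = norm (g (Suc m)) * (norm (1 - z * zh) * norm (amp z (Suc m) - 1)) + norm (g m - g (Suc m))"
      using z nzh by (simp add: norm_mult norm_power)
    also have "\<dots> \<le> growth * (K * (\<Sum>k. pert (k + Suc m))) + inv_a_bound * (growth * (\<Sum>k. pert (k + m)))"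
      using growth_pos norm_amp_le[OF nzh] unfolding g_def[symmetric]
      by (intro add_mono mult_mono[OF _ near_1] g_diff) auto
    finally show ?thesis unfolding T_def .
  qed
  have exact: "wronskian a (?J z) (?J zh) 0 / (zh - z) = of_real a0 * (g 0 + (\<Sum>m. t m z))"
    if z: "norm z = 1" and zne: "z \<noteq> zh" and wz: "norm (1 - z * zh) \<le> norm (1 - z\<^sup>2)" for z
  proof -
    define w where "w = z * zh"
    have z0: "z \<noteq> 0" using z by auto
    have w1: "1 - w = zh * (zh - z)" using sq by (simp add: w_def algebra_simps)
    then have wne: "1 - w \<noteq> 0" using zh0 zne by simp
    have nw: "norm w = 1" using z nzh by (simp add: w_def norm_mult)
    have sumt: "summable (\<lambda>m. t m z)"
      by (rule summable_comparison_test'[OF T, of 0]) (use t_bound[OF z wz] in blast)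
    define E where "E N = w ^ N * (of_real (a (int N)) * (amp z N * g (Suc N) - w * amp z (Suc N) * g N) / (1 - w)
        - of_real a0 * g N)" for N
    have wrN: "wronskian a (?J z) (?J zh) (int N) / (zh - z) = 
       w ^ N * (of_real (a (int N)) * (amp z N * g (Suc N) - w * amp z (Suc N) * g N) / (1 - w))" for N
    proof -
      have "wronskian a (?J z) (?J zh) (int N) = of_real (a (int N)) * (z ^ N * amp z N * (zh ^ Suc N * g (Suc N))
         - z ^ Suc N * amp z (Suc N) * (zh ^ N * g N))"
        using jost_plus_nat[OF z, of "Suc N"] jost_plus_nat[OF nzh, of "Suc N"]
        by (simp add: wronskian_def jost_plus_nat z nzh g_def add.commute)
      also have "\<dots> = zh * (w ^ N * (of_real (a (int N)) * (amp z N * g (Suc N) - w * amp z (Suc N) * g N)))"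
        using sq by (simp add: w_def power_mult_distrib algebra_simps)
      finally have "wronskian a (?J z) (?J zh) (int N) / (zh - z) =
          (zh / (zh - z)) * (w ^ N * (of_real (a (int N)) * (amp z N * g (Suc N) - w * amp z (Suc N) * g N)))"
        by simp
      also have "zh / (zh - z) = 1 / (1 - w)"
        unfolding w1 using zh0 zne sq by (simp add: frac_eq_eq)
      finally show ?thesis by simp
    qed
    \<comment> \<open>Splitting \<open>h g = (h - 1) g + g\<close> and summing the last part by parts.\<close>
    have parts: "(\<Sum>m<N. (1 - w) * w ^ m * amp z (Suc m) * g (Suc m)) = g 0 - w ^ N * g N + (\<Sum>m<N. t m z)" for N
      by (induction N) (simp_all add: t_def w_def algebra_simps)
    have const: "wronskian a (?J z) (?J zh) 0 / (zh - z) = E N + of_real a0 * (g 0 + (\<Sum>m<N. t m z))" for N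
    proof -
      have "wronskian a (?J z) (?J zh) 0 = wronskian a (?J z) (?J zh) (int N)
        + of_real a0 * ((z - zh)\<^sup>2 / z) * (\<Sum>k<N. ?J z (int (Suc k)) * ?J zh (int (Suc k)))"
        using wronskian_eq_sum[of a b "?J z" "spectral_param a0 b0 z" "?J zh" "spectral_param a0 b0 zh" N]
          is_jost_plus_jost_plus[OF z] is_jost_plus_jost_plus[OF nzh]
        unfolding spectral_param_diff[OF z0 zh, symmetric]
        by (simp add: is_jost_plus_def algebra_simps)
      also have "(\<Sum>k<N. ?J z (int (Suc k)) * ?J zh (int (Suc k))) = (\<Sum>k<N. w * w ^ k * amp z (Suc k) * g (Suc k))"
        unfolding jost_plus_nat[OF z] jost_plus_nat[OF nzh]
        by (simp add: w_def g_def power_mult_distrib algebra_simps)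
      finally have "wronskian a (?J z) (?J zh) 0 / (zh - z) = wronskian a (?J z) (?J zh) (int N) / (zh - z)
        + of_real a0 * (((z - zh)\<^sup>2 / z / (zh - z)) * (\<Sum>k<N. w * w ^ k * amp z (Suc k) * g (Suc k)))"
        by (simp add: add_divide_distrib)
      also have "(z - zh)\<^sup>2 / z / (zh - z) = (zh - z) / z"
        unfolding power2_commute[of z] using zne by (simp add: power2_eq_square)
      also have "(zh - z) / z * (\<Sum>k<N. w * w ^ k * amp z (Suc k) * g (Suc k)) = (\<Sum>m<N. (1 - w) * w ^ m * amp z (Suc m) * g (Suc m))"
      proof -
        have "(zh - z) / z * w = 1 - w" using z0 unfolding w1 by (simp add: w_def)
        then show ?thesis unfolding sum_distrib_left
          by (intro sum.cong refl) (metis mult.assoc)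
      qed
      finally show ?thesis unfolding wrN parts E_def by (simp add: algebra_simps)
    qed
    have "E \<longlonglongrightarrow> 0"
    proof (rule Lim_null_comparison)
      let ?e = "\<lambda>N. of_real (a (int N)) * (amp z N * g (Suc N) - w * amp z (Suc N) * g N) / (1 - w) - of_real a0 * g N"
      show "\<forall>\<^sub>F N in sequentially. norm (E N) \<le> norm (?e N)"
        using nw by (simp add: E_def norm_mult norm_power)
      have "?e \<longlonglongrightarrow> of_real a0 * (1 * 1 - w * 1 * 1) / (1 - w) - of_real a0 * 1"
        unfolding g_def
        by (intro tendsto_intros a_tendsto amp_tendsto_1 LIMSEQ_Suc z nzh wne)
      then have "?e \<longlonglongrightarrow> 0" using wne by simp
      then show "(\<lambda>N. norm (?e N)) \<longlonglongrightarrow> 0" by (rule tendsto_norm_zero)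
    qed
    then have "(\<lambda>N. E N + of_real a0 * (g 0 + (\<Sum>m<N. t m z))) \<longlonglongrightarrow> 0 + of_real a0 * (g 0 + (\<Sum>m. t m z))"
      by (intro tendsto_intros summable_LIMSEQ sumt)
    then show ?thesis unfolding const[symmetric] by (simp add: LIMSEQ_const_iff)
  qed
  have nontriv: "?F \<noteq> bot"
  proof -
    have "zh islimpt sphere 0 1"
    proof (rule connected_imp_perfect)
      show "connected (sphere 0 1 :: complex set)" by (rule connected_sphere) simp
      show "zh \<in> sphere 0 1" using nzh by simp
      show "sphere 0 1 \<noteq> {x}" for x :: complex
      proof
        assume x: "sphere 0 1 = {x}"
        have "(1 :: complex) \<in> sphere 0 1" "(-1 :: complex) \<in> sphere 0 1" by auto
        then show False unfolding x by auto
      qed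
    qed
    then show ?thesis by (simp add: trivial_limit_within)
  qed
  have "((\<lambda>z. \<Sum>m. t m z) \<longlongrightarrow> (\<Sum>m. - (g m - g (Suc m)))) ?F"
  proof (rule tannerys_theorem[THEN conjunct2, THEN conjunct2])
    fix m
    have "((\<lambda>z. amp z (Suc m)) \<longlongrightarrow> amp zh (Suc m)) ?F"
      using continuous_on_amp[of "Suc m"] nzh by (simp add: continuous_on_def)
    then have "(t m \<longlongrightarrow> (1 - zh * zh) * (zh * zh) ^ m * (amp zh (Suc m) - 1) * g (Suc m)
        - (zh * zh) ^ m * (g m - g (Suc m))) ?F"
      unfolding t_def by (intro tendsto_intros)
    then show "(t m \<longlongrightarrow> - (g m - g (Suc m))) ?F" by (simp add: sq)
    have "\<forall>\<^sub>F z in ?F. \<forall>m. norm (t m z) \<le> T m"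
      using near by eventually_elim (use t_bound in blast)
    then show "\<forall>\<^sub>F (m, z) in sequentially \<times>\<^sub>F ?F. norm (t m z) \<le> T m"
      unfolding eventually_prod_filter
      by (intro exI[of _ "\<lambda>_. True"] exI[of _ "\<lambda>z. \<forall>m. norm (t m z) \<le> T m"]) auto
  qed (use T nontriv in auto)
  also have "(\<Sum>m. - (g m - g (Suc m))) = 1 - g 0"
    using telescope_sums[OF amp_tendsto_1[OF nzh]] by (simp add: g_def sums_unique[symmetric])
  finally have "((\<lambda>z. of_real a0 * (g 0 + (\<Sum>m. t m z))) \<longlongrightarrow> of_real a0 * (g 0 + (1 - g 0))) ?F"
    by (intro tendsto_intros)
  moreover have "\<forall>\<^sub>F z in ?F. of_real a0 * (g 0 + (\<Sum>m. t m z)) = wronskian a (?J z) (?J zh) 0 / (zh - z)"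
    using near by eventually_elim (use exact in simp)
  ultimately show ?thesis by (auto intro: Lim_transform_eventually)
qed

end

section \<open>Reflection of the lattice\<close>

lemma is_jost_plus_cnj:
  assumes "is_jost_plus a0 b0 a b z \<phi>"
  shows "is_jost_plus a0 b0 a b (cnj z) (\<lambda>n. cnj (\<phi> n))"
proof -
  have "jacobi a b (\<lambda>n. cnj (\<phi> n)) n = cnj (jacobi a b \<phi> n)"
    and "spectral_param a0 b0 (cnj z) = cnj (spectral_param a0 b0 z)" for n
    by (simp_all add: jacobi_def spectral_param_def)
  moreover have "((\<lambda>n. cnj (z powi (- n) * \<phi> n)) \<longlongrightarrow> cnj 1) at_top"
    using assms unfolding is_jost_plus_def by (intro tendsto_cnj) blast
  ultimately show ?thesis using assms by (simp add: is_jost_plus_def)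
qed

lemma is_jost_plus_nonzero:
  assumes a: "\<And>n. a n > 0" and \<phi>: "is_jost_plus a0 b0 a b z \<phi>"
  shows "\<phi> 0 \<noteq> 0 \<or> \<phi> 1 \<noteq> 0"
proof (rule ccontr)
  assume "\<not> ?thesis"
  then have zero: "\<phi> 0 = 0" "\<phi> (0 + 1) = 0" by simp_all
  have "jacobi a b \<phi> n = spectral_param a0 b0 z * \<phi> n" for n
    using \<phi> by (simp add: is_jost_plus_def)
  from solution_eq_0[OF a this zero] have "\<phi> n = 0" for n .
  then have "((\<lambda>n::int. 0 :: complex) \<longlongrightarrow> 1) at_top" using \<phi> by (simp add: is_jost_plus_def)
  then show False by (simp add: tendsto_const_iff)
qed

lemma jacobi_reflect:
  "jacobi (\<lambda>n. a (- n)) (\<lambda>n. b (1 - n)) (\<lambda>n. c * \<phi> (1 - n)) n = c * jacobi a b \<phi> (1 - n)"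
proof -
  have "\<phi> (1 - (n - 1)) = \<phi> (1 - n + 1)" "a (- (n - 1)) = a (1 - n)"
    "\<phi> (1 - (n + 1)) = \<phi> (1 - n - 1)" "a (- n) = a (1 - n - 1)"
    by (auto intro: arg_cong[where f = \<phi>] arg_cong[where f = a])
  then show ?thesis unfolding jacobi_def by (simp only:) (simp only: distrib_left mult.left_commute add_ac)
qed

text \<open>
  The reflection \<open>n \<mapsto> 1 - n\<close> is chosen because it maps the pair of sites \<open>{0, 1}\<close>, at which the
  Wronskian is evaluated, to itself. The factor \<open>z\<close> corrects the normalization by the shift.
\<close>
lemma is_jost_minus_iff_reflect:
  assumes "z \<noteq> 0"
  shows "is_jost_minus a0 b0 a b z \<phi> \<longleftrightarrow>
    is_jost_plus a0 b0 (\<lambda>n. a (- n)) (\<lambda>n. b (1 - n)) z (\<lambda>n. z * \<phi> (1 - n))"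
proof -
  have "(\<forall>n. jacobi a b \<phi> n = spectral_param a0 b0 z * \<phi> n) \<longleftrightarrow>
    (\<forall>n. jacobi a b \<phi> (1 - n) = spectral_param a0 b0 z * \<phi> (1 - n))"
  proof
    assume "\<forall>n. jacobi a b \<phi> (1 - n) = spectral_param a0 b0 z * \<phi> (1 - n)"
    then have "jacobi a b \<phi> (1 - (1 - n)) = spectral_param a0 b0 z * \<phi> (1 - (1 - n))" for n by blast
    then show "\<forall>n. jacobi a b \<phi> n = spectral_param a0 b0 z * \<phi> n" by simp
  qed simp
  also have "\<dots> \<longleftrightarrow> (\<forall>n. jacobi (\<lambda>n. a (- n)) (\<lambda>n. b (1 - n)) (\<lambda>n. z * \<phi> (1 - n)) n
      = spectral_param a0 b0 z * (z * \<phi> (1 - n)))"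
    unfolding jacobi_reflect using assms by (simp add: mult.left_commute)
  finally have eqs: "(\<forall>n. jacobi a b \<phi> n = spectral_param a0 b0 z * \<phi> n) \<longleftrightarrow> \<dots>" .
  let ?f = "\<lambda>n. z powi n * \<phi> n"
  have f: "z powi (- n) * (z * \<phi> (1 - n)) = ?f (1 - n)" for n
    using assms by (simp add: power_int_diff power_int_minus field_simps)
  have top: "filterlim (\<lambda>n::int. 1 - n) at_bot at_top"
    unfolding filterlim_at_bot
  proof
    fix m :: int
    show "\<forall>\<^sub>F n in at_top. 1 - n \<le> m"
      using eventually_ge_at_top[of "1 - m"] by eventually_elim simp
  qed
  have bot: "filterlim (\<lambda>n::int. 1 - n) at_top at_bot"
    unfolding filterlim_at_top
  proof
    fix m :: int
    show "\<forall>\<^sub>F n in at_bot. m \<le> 1 - n"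
      using eventually_le_at_bot[of "1 - m"] by eventually_elim simp
  qed
  have "(?f \<longlongrightarrow> 1) at_bot \<longleftrightarrow> ((\<lambda>n. ?f (1 - n)) \<longlongrightarrow> 1) at_top"
    using filterlim_compose[OF _ top, of ?f "nhds 1"] filterlim_compose[OF _ bot, of "\<lambda>n. ?f (1 - n)" "nhds 1"]
    by auto
  with eqs show ?thesis by (simp only: is_jost_minus_def is_jost_plus_def f)
qed

lemma jost_minus_eq_reflect:
  assumes "jacobi_half_line a0 b0 (\<lambda>n. a (- n)) (\<lambda>n. b (1 - n))" and z: "norm z = 1"
  shows "jost_minus a0 b0 a b z = (\<lambda>n. inverse z * jost_plus a0 b0 (\<lambda>n. a (- n)) (\<lambda>n. b (1 - n)) z (1 - n))"
proof -
  interpret R: jacobi_half_line a0 b0 "\<lambda>n. a (- n)" "\<lambda>n. b (1 - n)" by fact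
  have z0: "z \<noteq> 0" using z by auto
  let ?J = "jost_plus a0 b0 (\<lambda>n. a (- n)) (\<lambda>n. b (1 - n)) z"
  show ?thesis
    unfolding jost_minus_def
  proof (rule the_equality)
    show "is_jost_minus a0 b0 a b z (\<lambda>n. inverse z * ?J (1 - n))"
      unfolding is_jost_minus_iff_reflect[OF z0]
      using R.is_jost_plus_jost_plus[OF z] z0 by (simp add: mult.assoc[symmetric])
  next
    fix \<phi> assume "is_jost_minus a0 b0 a b z \<phi>"
    then have "?J = (\<lambda>n. z * \<phi> (1 - n))"
      unfolding is_jost_minus_iff_reflect[OF z0] by (rule R.jost_plus_eqI[OF z])
    then show "\<phi> = (\<lambda>n. inverse z * ?J (1 - n))"
      using z0 by (simp add: mult.assoc[symmetric])
  qed
qed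

section \<open>Scattering data\<close>

text \<open>
  Existence uses that two solutions agreeing at the sites \<open>0\<close> and \<open>1\<close> coincide, with the Pluecker
  relation providing the agreement; uniqueness is Cramer's rule at these two sites.
\<close>
lemma scattering_data_eq:
  assumes a: "\<And>n. a n > 0"
    and M: "\<And>n. jacobi a b M n = l * M n" and P: "\<And>n. jacobi a b P n = l * P n" and Q: "\<And>n. jacobi a b Q n = l * Q n"
    and W: "wronskian a M P 0 \<noteq> 0"
  shows "(THE (T, R). \<forall>n. T * M n = Q n + R * P n) = (wronskian a Q P 0 / wronskian a M P 0, - wronskian a M Q 0 / wronskian a M P 0)"
proof (rule the_equality)
  define T where "T = wronskian a Q P 0 / wronskian a M P 0"
  define R where "R = - wronskian a M Q 0 / wronskian a M P 0"
  have "T * M k = Q k + R * P k" if "k \<in> {0, 0 + 1}" for k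
  proof -
    have "wronskian a M Q 0 * P k = wronskian a M P 0 * Q k - wronskian a Q P 0 * M k"
      by (rule wronskian_pluecker[OF that])
    then have "wronskian a Q P 0 * M k = wronskian a M P 0 * Q k - wronskian a M Q 0 * P k" by simp
    then have "T * M k = (wronskian a M P 0 * Q k - wronskian a M Q 0 * P k) / wronskian a M P 0" by (simp add: T_def)
    then show ?thesis using W by (simp add: R_def diff_divide_distrib)
  qed
  moreover have "jacobi a b (\<lambda>n. T * M n + 0 * P n) n = l * (T * M n + 0 * P n)" for n
    unfolding jacobi_lincomb M P by (simp add: algebra_simps)
  moreover have "jacobi a b (\<lambda>n. 1 * Q n + R * P n) n = l * (1 * Q n + R * P n)" for n
    unfolding jacobi_lincomb Q P by (simp add: algebra_simps)
  ultimately have "(\<lambda>n. T * M n + 0 * P n) = (\<lambda>n. 1 * Q n + R * P n)"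
    by (intro solution_unique[OF a, where k = 0 and b = b and l = l]) simp_all
  then show "case (T, R) of (T, R) \<Rightarrow> \<forall>n. T * M n = Q n + R * P n"
    by (simp add: fun_eq_iff)
next
  fix x assume x: "case x of (T, R) \<Rightarrow> \<forall>n. T * M n = Q n + R * P n"
  obtain T R where TR: "x = (T, R)" by (cases x)
  have Q: "Q n = T * M n - R * P n" for n using x TR by simp
  have "wronskian a Q P 0 = T * wronskian a M P 0" "- wronskian a M Q 0 = R * wronskian a M P 0"
    by (simp_all add: wronskian_def Q algebra_simps)
  then show "x = (wronskian a Q P 0 / wronskian a M P 0, - wronskian a M Q 0 / wronskian a M P 0)" using W TR by simp
qed

lemma quotient_combination:
  fixes A B W p q d m :: complex
  assumes "W * q = A * p - B * m" "q \<noteq> 0"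
  shows "(A / d * p - B / d * m) / q = W / d"
proof -
  have "A / d * p - B / d * m = W * q / d" unfolding assms(1) by (simp add: diff_divide_distrib)
  then show ?thesis using assms(2) by simp
qed

text \<open>
  The two solutions enter symmetrically, with \<open>\<kappa> = a0\<close> for one order and \<open>\<kappa> = - a0\<close> for the
  other, so that a single statement serves both reflection coefficients.
\<close>
lemma reflection_quotient_tendsto:
  fixes P M :: "complex \<Rightarrow> int \<Rightarrow> complex" and zh :: complex and c \<kappa> :: real
  defines "F \<equiv> at zh within sphere 0 1"
  assumes zh: "zh \<in> {1, -1}" and \<kappa>: "\<kappa> \<noteq> 0" and c: "c \<noteq> 0" and k: "k \<in> {0, 1}"
    and P: "((\<lambda>z. P z k) \<longlongrightarrow> P zh k) F" and M: "((\<lambda>z. M z k) \<longlongrightarrow> M zh k) F"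
    and WP: "((\<lambda>z. wronskian a (P z) (P zh) 0 / (zh - z)) \<longlongrightarrow> of_real \<kappa>) F"
    and WM: "((\<lambda>z. wronskian a (M z) (M zh) 0 / (zh - z)) \<longlongrightarrow> - of_real \<kappa>) F"
    and MP: "M zh 0 = of_real c * P zh 0" "M zh 1 = of_real c * P zh 1"
    and Pk: "P zh k \<noteq> 0" and Preal: "\<And>n. cnj (P zh n) = P zh n"
  shows "\<forall>\<^sub>F z in F. wronskian a (M z) (P z) 0 \<noteq> 0"
    and "\<exists>L. ((\<lambda>z. - wronskian a (M z) (\<lambda>n. cnj (P z n)) 0 / wronskian a (M z) (P z) 0) \<longlongrightarrow> L) F"
proof -
  have k': "k \<in> {0, 0 + 1}" using k by simp
  have Mk: "M zh k = of_real c * P zh k" using k MP by auto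
  have circle: "\<forall>\<^sub>F z in F. norm z = 1 \<and> z \<noteq> zh"
    unfolding F_def eventually_at by (intro exI[of _ 1]) auto
  have id: "((\<lambda>z. z) \<longlongrightarrow> zh) F" unfolding F_def by (rule tendsto_ident_at)
  have wr_scale: "wronskian a u (M zh) 0 = of_real c * wronskian a u (P zh) 0" for u
    using MP by (simp add: wronskian_def algebra_simps)
  have WMP: "((\<lambda>z. wronskian a (M z) (P zh) 0 / (zh - z)) \<longlongrightarrow> - of_real (\<kappa> / c)) F"
    using tendsto_mult[OF tendsto_const[of "inverse (of_real c)"] WM] c
    unfolding wr_scale by (simp add: field_simps)
  \<comment> \<open>Conjugation sends \<open>z\<close> to \<open>1 / z\<close> on the circle, which to first order reflects
    \<open>zhat - z\<close> and therefore changes the sign of the limit.\<close>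
  have WcP: "((\<lambda>z. wronskian a (\<lambda>n. cnj (P z n)) (P zh) 0 / (zh - z)) \<longlongrightarrow> - of_real \<kappa>) F"
  proof -
    have "((\<lambda>z. cnj (wronskian a (P z) (P zh) 0 / (zh - z)) * - (zh / z)) \<longlongrightarrow> cnj (of_real \<kappa>) * - (zh / zh)) F"
      by (intro tendsto_intros WP id) (use zh in auto)
    moreover have "\<forall>\<^sub>F z in F. cnj (wronskian a (P z) (P zh) 0 / (zh - z)) * - (zh / z)
        = wronskian a (\<lambda>n. cnj (P z n)) (P zh) 0 / (zh - z)"
      using circle
    proof eventually_elim
      case (elim z)
      have z: "z \<noteq> 0" "z \<noteq> zh" using elim by auto
      have "z * cnj z = 1" using elim by (simp add: complex_norm_square[symmetric])
      then have cz: "cnj z = 1 / z" using z by (simp add: field_simps)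
      have "cnj (wronskian a (P z) (P zh) 0) = wronskian a (\<lambda>n. cnj (P z n)) (P zh) 0"
        by (simp add: wronskian_def Preal)
      moreover have "cnj (zh - z) = (zh - z) * - (zh / z)"
        using zh z cz by (auto simp: field_simps)
      ultimately show ?case using zh z by auto
    qed
    ultimately show ?thesis using zh by (auto intro: Lim_transform_eventually)
  qed
  have den: "((\<lambda>z. wronskian a (M z) (P z) 0 / (zh - z)) \<longlongrightarrow> - of_real (\<kappa> * (c + 1 / c))) F"
  proof -
    have "((\<lambda>z. (wronskian a (M z) (P zh) 0 / (zh - z) * P z k - wronskian a (P z) (P zh) 0 / (zh - z) * M z k) / P zh k)
       \<longlongrightarrow> (- of_real (\<kappa> / c) * P zh k - of_real \<kappa> * M zh k) / P zh k) F"
      by (intro tendsto_intros WMP WP P M Pk)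
    moreover have "(wronskian a (M z) (P zh) 0 / (zh - z) * P z k - wronskian a (P z) (P zh) 0 / (zh - z) * M z k) / P zh k
       = wronskian a (M z) (P z) 0 / (zh - z)" for z
      by (rule quotient_combination[OF wronskian_pluecker[OF k', of a "M z" "P z" "P zh"] Pk])
    moreover have "(- of_real (\<kappa> / c) * P zh k - of_real \<kappa> * M zh k) / P zh k = - of_real (\<kappa> * (c + 1 / c))"
    proof -
      have "(- x * q - y * (w * q)) / q = - x - y * w" if "q \<noteq> 0" for x y w q :: complex
        using that by (simp add: field_simps)
      then have "(- of_real (\<kappa> / c) * P zh k - of_real \<kappa> * M zh k) / P zh k = - of_real (\<kappa> / c) - of_real \<kappa> * of_real c"
        unfolding Mk using Pk by blast
      then show ?thesis by (simp add: distrib_left)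
    qed
    ultimately show ?thesis by simp
  qed
  have num: "((\<lambda>z. wronskian a (M z) (\<lambda>n. cnj (P z n)) 0 / (zh - z)) \<longlongrightarrow> of_real (\<kappa> * (c - 1 / c))) F"
  proof -
    have "((\<lambda>z. (wronskian a (M z) (P zh) 0 / (zh - z) * cnj (P z k) - wronskian a (\<lambda>n. cnj (P z n)) (P zh) 0 / (zh - z) * M z k) / P zh k)
       \<longlongrightarrow> (- of_real (\<kappa> / c) * cnj (P zh k) - (- of_real \<kappa>) * M zh k) / P zh k) F"
      by (intro tendsto_intros WMP WcP P M Pk)
    moreover have "(wronskian a (M z) (P zh) 0 / (zh - z) * cnj (P z k) - wronskian a (\<lambda>n. cnj (P z n)) (P zh) 0 / (zh - z) * M z k) / P zh k
       = wronskian a (M z) (\<lambda>n. cnj (P z n)) 0 / (zh - z)" for z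
      by (rule quotient_combination[OF wronskian_pluecker[OF k', of a "M z" "\<lambda>n. cnj (P z n)" "P zh"] Pk])
    moreover have "(- of_real (\<kappa> / c) * cnj (P zh k) - (- of_real \<kappa>) * M zh k) / P zh k = of_real (\<kappa> * (c - 1 / c))"
    proof -
      have "(- x * q - (- y) * (w * q)) / q = y * w - x" if "q \<noteq> 0" for x y w q :: complex
        using that by (simp add: field_simps)
      then have "(- of_real (\<kappa> / c) * cnj (P zh k) - (- of_real \<kappa>) * M zh k) / P zh k = of_real \<kappa> * of_real c - of_real (\<kappa> / c)"
        unfolding Mk Preal using Pk by blast
      then show ?thesis by (simp add: right_diff_distrib)
    qed
    ultimately show ?thesis by simp
  qed
  have nz: "- of_real (\<kappa> * (c + 1 / c)) \<noteq> (0 :: complex)"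
  proof -
    have "c * (c + 1 / c) = c * c + 1" using c by (simp add: field_simps)
    also have "\<dots> > 0" by (simp add: add_nonneg_pos)
    finally have "c + 1 / c \<noteq> 0" by auto
    then have "\<kappa> * (c + 1 / c) \<noteq> 0" using \<kappa> by simp
    then show ?thesis unfolding neg_equal_0_iff_equal of_real_eq_0_iff .
  qed
  show "\<forall>\<^sub>F z in F. wronskian a (M z) (P z) 0 \<noteq> 0"
    using tendsto_imp_eventually_ne[OF den nz] by eventually_elim auto
  have "((\<lambda>z. - (wronskian a (M z) (\<lambda>n. cnj (P z n)) 0 / (zh - z)) / (wronskian a (M z) (P z) 0 / (zh - z)))
      \<longlongrightarrow> - of_real (\<kappa> * (c - 1 / c)) / - of_real (\<kappa> * (c + 1 / c))) F"
    by (rule tendsto_divide[OF tendsto_minus[OF num] den nz])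
  moreover have "\<forall>\<^sub>F z in F. - (wronskian a (M z) (\<lambda>n. cnj (P z n)) 0 / (zh - z)) / (wronskian a (M z) (P z) 0 / (zh - z))
      = - wronskian a (M z) (\<lambda>n. cnj (P z n)) 0 / wronskian a (M z) (P z) 0"
    using circle by eventually_elim auto
  ultimately show "\<exists>L. ((\<lambda>z. - wronskian a (M z) (\<lambda>n. cnj (P z n)) 0 / wronskian a (M z) (P z) 0) \<longlongrightarrow> L) F"
    by (blast intro: Lim_transform_eventually)
qed

section \<open>Continuity of the reflection coefficients\<close>

text \<open>
  The weight \<open>n + 1\<close> exceeds \<open>2 n\<close> at \<open>n = 0\<close> only, so the comparison with the first moment
  starts at \<open>n = 1\<close>.
\<close>
lemma summable_int_half_lines:
  fixes q :: "int \<Rightarrow> real"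
  assumes "(\<lambda>n. \<bar>real_of_int n\<bar> * q n) summable_on UNIV" and nn: "\<And>n. q n \<ge> 0"
  shows "summable (\<lambda>n. real (Suc n) * (q (int n) + q (int n + 1)))"
    and "summable (\<lambda>n. real (Suc n) * (q (- int n) + q (- int n - 1)))"
proof -
  let ?f = "\<lambda>n. \<bar>real_of_int n\<bar> * q n"
  have half: "summable (\<lambda>n. real (Suc n) * (q (s * int n) + q (s * int (Suc n))))" if s: "s \<in> {1, -1}" for s :: int
  proof -
    have inj: "inj (\<lambda>n. s * int n)" using s by (auto simp: inj_def)
    have "?f summable_on range (\<lambda>n. s * int n)"
      using assms(1) by (rule summable_on_subset_banach) simp
    then have "(?f \<circ> (\<lambda>n. s * int n)) summable_on UNIV"
      using summable_on_reindex[OF inj, of ?f] by simp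
    then have 1: "summable (\<lambda>n. ?f (s * int n))"
      by (auto simp: o_def dest: summable_on_imp_summable)
    then have 2: "summable (\<lambda>n. ?f (s * int (Suc n)))"
      using summable_Suc_iff[of "\<lambda>n. ?f (s * int n)"] by blast
    have abs_s: "\<bar>real_of_int (s * int n)\<bar> = real n" for n using s by auto
    show ?thesis
    proof (rule summable_comparison_test'[OF summable_add[OF summable_mult[OF 1, of 2] 2], of 1])
      fix n :: nat assume "n \<ge> 1"
      then have "real (Suc n) * q (s * int n) \<le> 2 * real n * q (s * int n)"
        by (intro mult_right_mono nn) simp
      then show "norm (real (Suc n) * (q (s * int n) + q (s * int (Suc n))))
          \<le> 2 * ?f (s * int n) + ?f (s * int (Suc n))"
        unfolding abs_s using nn[of "s * int n"] nn[of "s * int (Suc n)"] by (simp add: distrib_left)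
    qed
  qed
  show "summable (\<lambda>n. real (Suc n) * (q (int n) + q (int n + 1)))"
    using half[of 1] by (simp add: add.commute)
  have left: "- int n - 1 = - 1 * int (Suc n)" for n by simp
  then show "summable (\<lambda>n. real (Suc n) * (q (- int n) + q (- int n - 1)))"
    using half[of "-1"] unfolding left by simp
qed

theorem mainTheorem4:
  fixes a0 b0 :: real
    and a b :: "int \<Rightarrow> real"
    and zhat :: complex
  assumes "a0 > 0"
    and "\<And>n. a n > 0"
    and "(\<lambda>n::int. \<bar>real_of_int n\<bar> * (\<bar>a n - a0\<bar> + \<bar>b n - b0\<bar>)) summable_on UNIV"
    and "zhat \<in> {1, -1}"
    and "jost_wronskian a0 b0 a b zhat = 0"
  shows "(\<exists>L. (refl_plus a0 b0 a b \<longlongrightarrow> L) (at zhat within sphere 0 1)) \<and>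
         (\<exists>L. (refl_minus a0 b0 a b \<longlongrightarrow> L) (at zhat within sphere 0 1))"
proof -
  define a' where "a' = (\<lambda>n. a (- n))"
  define b' where "b' = (\<lambda>n. b (1 - n))"
  define P where "P = jost_plus a0 b0 a b"
  define M where "M = jost_minus a0 b0 a b"
  define J' where "J' = jost_plus a0 b0 a' b'"
  let ?F = "at zhat within sphere 0 (1 :: real)"
  let ?l = "spectral_param a0 b0"
  let ?q = "\<lambda>n. \<bar>a n - a0\<bar> + \<bar>b n - b0\<bar>"
  have nz: "norm zhat = 1" "zhat \<noteq> 0" using assms(4) by auto
  note halves = summable_int_half_lines[of ?q, OF assms(3)]
  interpret L: jacobi_half_line a0 b0 a b
  proof
    show "summable (\<lambda>n. real (Suc n) * (\<bar>a (int n) - a0\<bar> + \<bar>a (int n + 1) - a0\<bar> + \<bar>b (int n + 1) - b0\<bar>))"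
      by (rule summable_comparison_test'[OF halves(1), of 0]) (auto intro!: mult_left_mono)
  qed (use assms in auto)
  interpret R: jacobi_half_line a0 b0 a' b'
  proof
    show "summable (\<lambda>n. real (Suc n) * (\<bar>a' (int n) - a0\<bar> + \<bar>a' (int n + 1) - a0\<bar> + \<bar>b' (int n + 1) - b0\<bar>))"
      unfolding a'_def b'_def
      by (rule summable_comparison_test'[OF halves(2), of 0]) (auto intro!: mult_left_mono)
  qed (use assms in \<open>auto simp: a'_def\<close>)
  have M_eq: "M z n = inverse z * J' z (1 - n)" if "norm z = 1" for z n
    using jost_minus_eq_reflect[of a0 b0 a b z] R.jacobi_half_line_axioms that
    by (simp add: M_def J'_def a'_def b'_def)
  have P_sol: "jacobi a b (P z) n = ?l z * P z n" if "norm z = 1" for z n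
    using L.is_jost_plus_jost_plus[OF that] by (simp add: is_jost_plus_def P_def)
  have M_sol: "jacobi a b (M z) n = ?l z * M z n" if "norm z = 1" for z n
  proof -
    have "z \<noteq> 0" using that by auto
    then have "is_jost_minus a0 b0 a b z (M z)"
      using R.is_jost_plus_jost_plus[OF that] unfolding is_jost_minus_iff_reflect[OF \<open>z \<noteq> 0\<close>] M_eq[OF that]
      by (simp add: a'_def b'_def J'_def mult.assoc[symmetric])
    then show ?thesis by (simp add: is_jost_minus_def)
  qed
  have cnj_sol: "jacobi a b (\<lambda>n. cnj (u n)) n = ?l z * cnj (u n)"
    if "norm z = 1" "\<And>n. jacobi a b u n = ?l z * u n" for z u n
  proof -
    have "z * cnj z = 1" using that by (simp add: complex_norm_square[symmetric])
    then have "cnj z = inverse z" by (metis inverse_unique)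
    then have "cnj (?l z) = ?l z" by (simp add: spectral_param_def add.commute)
    then show ?thesis using arg_cong[OF that(2)[of n], of cnj] by (simp add: jacobi_def)
  qed
  have cnj_zhat: "cnj zhat = zhat" using assms(4) by auto
  have P_real: "cnj (P zhat n) = P zhat n" for n
    using L.jost_plus_eqI[OF nz(1) is_jost_plus_cnj[OF L.is_jost_plus_jost_plus[OF nz(1)], unfolded cnj_zhat]]
    by (simp add: P_def fun_eq_iff)
  have J'_real: "cnj (J' zhat n) = J' zhat n" for n
    using R.jost_plus_eqI[OF nz(1) is_jost_plus_cnj[OF R.is_jost_plus_jost_plus[OF nz(1)], unfolded cnj_zhat]]
    by (simp add: J'_def fun_eq_iff)
  have M_real: "cnj (M zhat n) = M zhat n" for n
    by (simp add: M_eq nz J'_real cnj_zhat)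
  have circle: "\<forall>\<^sub>F z in ?F. norm z = 1"
    unfolding eventually_at by (intro exI[of _ 1]) auto
  have P_lim: "((\<lambda>z. P z k) \<longlongrightarrow> P zhat k) ?F" if "k \<in> {0, 1}" for k
    using L.jost_plus_tendsto[OF nz(1), of 0] L.jost_plus_tendsto[OF nz(1), of 1] that by (auto simp: P_def)
  have M_lim: "((\<lambda>z. M z k) \<longlongrightarrow> M zhat k) ?F" if k: "k \<in> {0, 1}" for k
  proof -
    have "((\<lambda>z. J' z (1 - k)) \<longlongrightarrow> J' zhat (1 - k)) ?F"
      using R.jost_plus_tendsto[OF nz(1), of 0] R.jost_plus_tendsto[OF nz(1), of 1] k by (auto simp: J'_def)
    then have "((\<lambda>z. inverse z * J' z (1 - k)) \<longlongrightarrow> inverse zhat * J' zhat (1 - k)) ?F"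
      using nz by (intro tendsto_mult tendsto_inverse tendsto_ident_at) auto
    moreover have "\<forall>\<^sub>F z in ?F. inverse z * J' z (1 - k) = M z k"
      using circle by eventually_elim (simp add: M_eq)
    ultimately show ?thesis unfolding M_eq[OF nz(1), symmetric] by (rule Lim_transform_eventually)
  qed
  have WP: "((\<lambda>z. wronskian a (P z) (P zhat) 0 / (zhat - z)) \<longlongrightarrow> of_real a0) ?F"
    unfolding P_def by (rule L.wronskian_asymptotics[OF assms(4)])
  have WM: "((\<lambda>z. wronskian a (M z) (M zhat) 0 / (zhat - z)) \<longlongrightarrow> - of_real a0) ?F"
  proof -
    have "((\<lambda>z. - (inverse z * inverse zhat) * (wronskian a' (J' z) (J' zhat) 0 / (zhat - z)))
        \<longlongrightarrow> - (inverse zhat * inverse zhat) * of_real a0) ?F"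
      unfolding J'_def
      using nz by (intro tendsto_mult tendsto_minus tendsto_inverse tendsto_ident_at tendsto_const R.wronskian_asymptotics[OF assms(4)]) auto
    moreover have "\<forall>\<^sub>F z in ?F. - (inverse z * inverse zhat) * (wronskian a' (J' z) (J' zhat) 0 / (zhat - z))
        = wronskian a (M z) (M zhat) 0 / (zhat - z)"
      using circle
    proof eventually_elim
      case (elim z)
      have "wronskian a (M z) (M zhat) 0 = - (inverse z * inverse zhat) * wronskian a' (J' z) (J' zhat) 0"
        by (simp add: wronskian_def a'_def M_eq elim nz algebra_simps)
      then show ?case by simp
    qed
    moreover have "inverse zhat * inverse zhat = 1" using assms(4) by auto
    ultimately show ?thesis by (auto intro: Lim_transform_eventually)
  qed
  \<comment> \<open>The resonance condition: at the edge the two Jost solutions are proportional, and since both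
    are real and nonzero, the factor \<open>c\<close> found below is real and nonzero.\<close>
  have cross: "M zhat 0 * P zhat 1 = M zhat 1 * P zhat 0"
    using assms(5) assms(2)[of 0] by (simp add: jost_wronskian_def P_def M_def)
  have P_nz: "P zhat 0 \<noteq> 0 \<or> P zhat 1 \<noteq> 0"
    unfolding P_def by (rule is_jost_plus_nonzero[OF assms(2) L.is_jost_plus_jost_plus[OF nz(1)]])
  have M_nz: "M zhat 0 \<noteq> 0 \<or> M zhat 1 \<noteq> 0"
    using is_jost_plus_nonzero[OF R.a_pos R.is_jost_plus_jost_plus[OF nz(1)]] nz
    by (auto simp: M_eq J'_def)
  obtain k :: int where k: "k \<in> {0, 1}" "P zhat k \<noteq> 0" "M zhat k \<noteq> 0"
    using cross P_nz M_nz by (metis insertCI mult_eq_0_iff)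
  define c where "c = Re (M zhat k) / Re (P zhat k)"
  have re: "P zhat n = of_real (Re (P zhat n))" "M zhat n = of_real (Re (M zhat n))" for n
    using P_real[of n] M_real[of n] by (simp_all add: complex_eq_iff)
  have c_eq: "of_real c = M zhat k / P zhat k"
    unfolding c_def of_real_divide re[symmetric] ..
  then have c: "c \<noteq> 0" using k by auto
  have MP: "M zhat 0 = of_real c * P zhat 0" "M zhat 1 = of_real c * P zhat 1"
    unfolding c_eq using k cross by (auto simp: field_simps)
  have PM: "P zhat 0 = of_real (1 / c) * M zhat 0" "P zhat 1 = of_real (1 / c) * M zhat 1"
    using MP c by (auto simp: field_simps)
  have plus_eq: "refl_plus a0 b0 a b z = - wronskian a (M z) (\<lambda>n. cnj (P z n)) 0 / wronskian a (M z) (P z) 0"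
    if "norm z = 1" "wronskian a (M z) (P z) 0 \<noteq> 0" for z
    unfolding refl_plus_def scattering_plus_def
    using scattering_data_eq[OF assms(2) M_sol P_sol cnj_sol[OF _ P_sol], OF that(1) that(1) that(1) that(1) that(2)]
    by (simp add: P_def M_def)
  have minus_eq: "refl_minus a0 b0 a b z = - wronskian a (P z) (\<lambda>n. cnj (M z n)) 0 / wronskian a (P z) (M z) 0"
    if "norm z = 1" "wronskian a (P z) (M z) 0 \<noteq> 0" for z
    unfolding refl_minus_def scattering_minus_def
    using scattering_data_eq[OF assms(2) P_sol M_sol cnj_sol[OF _ M_sol], OF that(1) that(1) that(1) that(1) that(2)]
    by (simp add: P_def M_def)
  have "a0 \<noteq> 0" "- a0 \<noteq> 0" "1 / c \<noteq> 0" using assms(1) c by auto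
  note plus = reflection_quotient_tendsto[OF assms(4) \<open>a0 \<noteq> 0\<close> c k(1) P_lim[OF k(1)] M_lim[OF k(1)] WP WM MP k(2) P_real]
  have "((\<lambda>z. wronskian a (M z) (M zhat) 0 / (zhat - z)) \<longlongrightarrow> of_real (- a0)) ?F"
    "((\<lambda>z. wronskian a (P z) (P zhat) 0 / (zhat - z)) \<longlongrightarrow> - of_real (- a0)) ?F"
    using WM WP by auto
  note minus = reflection_quotient_tendsto[OF assms(4) \<open>- a0 \<noteq> 0\<close> \<open>1 / c \<noteq> 0\<close> k(1) M_lim[OF k(1)] P_lim[OF k(1)] this PM k(3) M_real]
  have "\<forall>\<^sub>F z in ?F. - wronskian a (M z) (\<lambda>n. cnj (P z n)) 0 / wronskian a (M z) (P z) 0 = refl_plus a0 b0 a b z"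
    using circle plus(1) by eventually_elim (simp add: plus_eq)
  moreover have "\<forall>\<^sub>F z in ?F. - wronskian a (P z) (\<lambda>n. cnj (M z n)) 0 / wronskian a (P z) (M z) 0 = refl_minus a0 b0 a b z"
    using circle minus(1) by eventually_elim (simp add: minus_eq)
  ultimately show ?thesis
    using plus(2) minus(2) by (blast intro: Lim_transform_eventually)
qed

end
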